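(* Let $m$ be any positive rational number and let $\Lambda=\left(\frac{g_{7m}}{g_{m/7}}\right)^2$. Write $a=a_{m,7}$, $b=b_{4m,7}$, $S=\frac ab-\frac ba$, $T=\frac{1}{ab}-ab$ and $L=\Lambda-\frac1\Lambda$. Then $$S^2=S\left(L^3-5L\right)-8L^2,$$ $$2401\,T^2=49\,T\left(L^9-7L^7-37L^5+77L^3+294L\right)+L^{12}-20L^{10}+86L^8-2065L^6-16317L^4-22981L^2.$$
   Context: For $|q|<1$: $\varphi(q)=\sum_{n\in\mathbb Z}q^{n^2}$, $\psi(q)=\sum_{n\ge0}q^{n(n+1)/2}$, $(a;q)_\infty=\prod_{k\ge0}(1-aq^k)$, $\chi(q)=(-q;q^2)_\infty$. For positive rational $r$, the Ramanujan class invariant is $g_r=2^{-1/4}q^{-1/24}\chi(-q)$ with $q=e^{-\pi\sqrt r}$. For positive rationals $m,n$, $$a_{m,n}=\frac{n\,q^{(n-1)/4}\psi^2(q^n)\varphi^2(-q^{2n})}{\psi^2(q)\varphi^2(-q^2)},\quad q=e^{-\pi\sqrt{m/n}},$$ and $$b_{m,n}=\frac{n\,q^{(n-1)/4}\psi^2(q^n)\varphi^2(-q^{n})}{\psi^2(q)\varphi^2(-q)},\quad q=e^{-\pi\sqrt{m/n}}.$$ *)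

theory Defs
  imports "HOL-Analysis.Analysis"
begin

text \<open>
  The theta functions and products below are meaningful for \<open>norm q < 1\<close>, where the series
  converge absolutely and the product converges. They are polymorphic so that they cover both
  real and complex \<open>q\<close>; in the class invariant and the quantities \<open>a\<close>, \<open>b\<close> only
  real \<open>q\<close> occurs.
\<close>

definition theta_phi :: "'a::{real_normed_field,banach} \<Rightarrow> 'a" where
  "theta_phi q = (\<Sum>\<^sub>\<infinity>n\<in>(UNIV :: int set). q powi (n\<^sup>2))"

definition theta_psi :: "'a::{real_normed_field,banach} \<Rightarrow> 'a" where
  "theta_psi q = (\<Sum>n. q ^ (n * (n + 1) div 2))"

definition qpoch_inf :: "'a \<Rightarrow> 'a \<Rightarrow> 'a::{real_normed_field,banach}" where
  "qpoch_inf a q = prodinf (\<lambda>k. 1 - a * q ^ k)"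

definition theta_chi :: "'a::{real_normed_field,banach} \<Rightarrow> 'a" where
  "theta_chi q = qpoch_inf (- q) (q\<^sup>2)"

text \<open>
  The parameters \<open>r\<close>, \<open>m\<close>, \<open>n\<close> are intended to be positive rationals; they are taken of type
  \<open>real\<close> to avoid coercions. As \<open>n\<close> need not be an integer, the powers of the
  positive real \<open>q\<close> involving \<open>n\<close> are real powers.
\<close>

definition class_inv_g :: "real \<Rightarrow> real" where
  "class_inv_g r = (let q = exp (- pi * sqrt r)
     in 2 powr (- 1 / 4) * q powr (- 1 / 24) * theta_chi (- q))"

definition a_quot :: "real \<Rightarrow> real \<Rightarrow> real" where
  "a_quot m n = (let q = exp (- pi * sqrt (m / n))
     in n * q powr ((n - 1) / 4) * (theta_psi (q powr n))\<^sup>2 * (theta_phi (- (q powr (2 * n))))\<^sup>2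
        / ((theta_psi q)\<^sup>2 * (theta_phi (- (q\<^sup>2)))\<^sup>2))"

definition b_quot :: "real \<Rightarrow> real \<Rightarrow> real" where
  "b_quot m n = (let q = exp (- pi * sqrt (m / n))
     in n * q powr ((n - 1) / 4) * (theta_psi (q powr n))\<^sup>2 * (theta_phi (- (q powr n)))\<^sup>2
        / ((theta_psi q)\<^sup>2 * (theta_phi (- q))\<^sup>2))"

end

(*
Write f(q) = (q;q)_oo, X = chi(q), C = chi(-q), X7 = chi(q^7), C7 = chi(-q^7) at q = exp(-pi sqrt(m/7)).
Every quantity in the theorem is a monomial in these, in q and in f(q^14)/f(q^2). Three theta identities
suffice. Re-indexing phi(q)^2 along the two cosets of {(n,m) : n + m even} gives Jacobi's
X^8 - C^8 = 16 q / (XC)^8, and multiplication by (1 - sqrt(-7))/4 on n^2 + 7 m^2 gives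
psi(q) psi(q^7) - psi(-q) psi(-q^7) = 2 q psi(q^2) psi(q^14), that is
X X7 - C C7 = 2 q / (X X7 C C7). With t = (C C7)^3 / q and y = Lambda^2, eliminating X and X7 from these
shows that y + 1/y and t + 8/t + 7 have the same value of k^3 - 3 k, hence are equal. From this
S = t L follows, which is the first relation.

The relation for T also involves f(q^14)/f(q^2). Squaring f(q)^3 = sum_i (4i+1) q^(i(2i+1)) and rotating
the lattice expresses the Wronskian of psi(q^2) and phi(q) as a product, so q d/dq log C is known.
Differentiating y + 1/y = t + 8/t + 7 then expresses (f(q^14)/f(q^2))^4 in t and y, and
49 T = L R(t) with R = t^4 + 13 t^3 + 40 t^2 - 5 t + 8 - 8/t. Both relations of the theorem are the
quadratic equations satisfied by S and T over the field generated by L, since L^2 = t + 8/t + 5.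
*)
theory Submission
  imports Defs
begin

section \<open>Sums over the integers\<close>

text \<open>In eta quotients, \<open>t\<close> is (eta(z) eta(7z) / (eta(2z) eta(14z)))^3 and
  \<open>y\<close> is (eta(2z) eta(7z) / (eta(z) eta(14z)))^4, q = exp(2 pi i z). Neither X nor X7
  is a rational function of these, so X and X7 must enter through combinations from which they drop
  out: X^8 + 16 q / (X C)^8 has a square depending on C alone, and the product of this quantity with
  its counterpart at q^7 depends on C C7 alone. The squares contain C^24 and C7^24 only, hence y^3
  but not y; this is why y + 1/y is first known through its cubic k^3 - 3 k, and why real positivity
  is used to return to y + 1/y. The chi identities contain no f, so they cannot determine
  f(q^14)/f(q^2). Differentiating a relation of weight 0 gives one of weight 2, in which f(q^2)^4
  and f(q^14)^4 appear as factors of two Eisenstein series. The ratio of these series is rational in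
  t and y by the differentiated relation, while its square is a rational function of t and y times
  (a b) \<Lambda>; comparing the two yields a b. The last step is a conjugation: t -> 8/t fixes L^2
  but moves S / L and R.\<close>

definition tri :: "int \<Rightarrow> int" where "tri j = j * (j + 1) div 2"

lemma two_tri: "2 * tri j = j * (j + 1)"
  unfolding tri_def by (simp add: even_mult_iff)

lemma tri_diff: "tri (j - 1) = tri j - j"
  using two_tri[of j] two_tri[of "j - 1"] by (simp add: algebra_simps)

lemma tri_add: "tri (j + 1) = tri j + j + 1"
  using two_tri[of j] two_tri[of "j + 1"] by (simp add: algebra_simps)

lemma tri_reflect: "tri (-1 - j) = tri j"
  using two_tri[of j] two_tri[of "-1-j"] by (simp add: algebra_simps)

lemma tri_of_nat: "tri (int n) = int (n * (n + 1) div 2)"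
  unfolding tri_def by (simp add: zdiv_int algebra_simps)

lemma tri_nonneg: "tri j \<ge> 0"
proof -
  have "0 \<le> j * (j + 1)"
    by (cases "j \<ge> 0") (auto simp: mult_nonneg_nonneg mult_nonpos_nonpos)
  then show ?thesis using two_tri[of j] by linarith
qed

lemma UNIV_int_split: "(UNIV :: int set) = range int \<union> range (\<lambda>n. -1 - int n)"
proof (intro equalityI subsetI UnCI)
  fix x :: int assume x: "x \<notin> range (\<lambda>n. -1 - int n)"
  have "x \<ge> 0"
  proof (rule ccontr)
    assume "\<not> x \<ge> 0"
    then have "x = -1 - int (nat (-1 - x))" by simp
    with x show False by blast
  qed
  then show "x \<in> range int" by (metis nonneg_int_cases rangeI)
qed auto

lemma has_sum_int_split:
  fixes f :: "int \<Rightarrow> 'a::{topological_comm_monoid_add}"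
  assumes "((\<lambda>n. f (int n)) has_sum a) UNIV" "((\<lambda>n. f (-1 - int n)) has_sum b) UNIV"
  shows "(f has_sum (a + b)) UNIV"
proof -
  have "(f has_sum a) (range int)"
    using assms(1) by (subst has_sum_reindex) (auto simp: o_def)
  moreover have "(f has_sum b) (range (\<lambda>n. -1 - int n))"
    using assms(2) by (subst has_sum_reindex) (auto simp: o_def inj_on_def)
  ultimately show ?thesis
    unfolding UNIV_int_split by (rule has_sum_Un_disjoint) auto
qed

lemma summable_int_split:
  fixes f :: "int \<Rightarrow> 'a::{topological_comm_monoid_add}"
  assumes "(\<lambda>n. f (int n)) summable_on UNIV" "(\<lambda>n. f (-1 - int n)) summable_on UNIV"
  shows "f summable_on UNIV"
  using assms has_sum_int_split[of f] unfolding summable_on_def by blast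

lemma summable_theta_nat:
  fixes q x :: real
  assumes "0 < q" "q < 1" "0 < x"
  shows "summable (\<lambda>n. real (n + 1) ^ 2 * x ^ n * q ^ (n * (n + 1) div 2))"
proof -
  \<comment> \<open>The ratio of consecutive terms is at most this quantity; the 4 comes from (n +
    2)^2 <= 4 (n + 1)^2.\<close>
  have "(\<lambda>n. 4 * x * q ^ Suc n) \<longlonglongrightarrow> 4 * x * 0"
    by (intro tendsto_mult_left LIMSEQ_Suc LIMSEQ_realpow_zero) (use assms in auto)
  then have "eventually (\<lambda>n. 4 * x * q ^ Suc n < 1/2) sequentially"
    by (intro order_tendstoD) auto
  then obtain N where N: "\<And>n. n \<ge> N \<Longrightarrow> 4 * x * q ^ Suc n < 1/2"
    unfolding eventually_sequentially by blast
  show ?thesis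
  proof (rule summable_ratio_test[of "1/2" N])
    fix n assume n: "n \<ge> N"
    have e: "Suc n * (Suc n + 1) div 2 = n * (n + 1) div 2 + Suc n" by auto
    have "real (Suc n + 1) ^ 2 \<le> 4 * real (n + 1) ^ 2"
      by (auto simp: power2_eq_square algebra_simps)
    then have "real (Suc n + 1) ^ 2 * (x ^ n * q ^ (n * (n + 1) div 2) * (x * q ^ Suc n))
       \<le> 4 * real (n + 1) ^ 2 * (x ^ n * q ^ (n * (n + 1) div 2) * (x * q ^ Suc n))"
      by (rule mult_right_mono) (use assms in auto)
    also have "\<dots> = real (n + 1) ^ 2 * x ^ n * q ^ (n * (n + 1) div 2) * (4 * x * q ^ Suc n)"
      by (simp add: algebra_simps)
    also have "\<dots> \<le> real (n + 1) ^ 2 * x ^ n * q ^ (n * (n + 1) div 2) * (1/2)"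
      by (rule mult_left_mono) (use assms N[OF n] in auto)
    finally show "norm (real (Suc n + 1) ^ 2 * x ^ Suc n * q ^ (Suc n * (Suc n + 1) div 2))
        \<le> 1/2 * norm (real (n + 1) ^ 2 * x ^ n * q ^ (n * (n + 1) div 2))"
      unfolding e power_add using assms by (simp add: algebra_simps abs_mult)
  qed simp
qed

text \<open>One quadratic weight dominates all series that occur: plain theta series, the linear
  weight in the cube identity, and the quadratic weight produced by differentiation in
  \<open>q\<close>. The negative half reduces to the positive one by \<open>tri_reflect\<close>,
  with \<open>z\<close> inverted.\<close>

lemma summable_theta:
  fixes q z :: real
  assumes "0 < q" "q < 1" "z \<noteq> 0"
  shows "(\<lambda>j. (1 + \<bar>of_int j\<bar>) ^ 2 * \<bar>z\<bar> powi j * q powi tri j) summable_on UNIV"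
proof (rule summable_int_split)
  have "(\<lambda>n. real (n + 1) ^ 2 * \<bar>z\<bar> ^ n * q ^ (n * (n + 1) div 2)) summable_on UNIV"
    by (rule summable_nonneg_imp_summable_on[OF summable_theta_nat]) (use assms in auto)
  then show "(\<lambda>n. (1 + \<bar>of_int (int n)\<bar>) ^ 2 * \<bar>z\<bar> powi int n * q powi tri (int n)) summable_on UNIV"
    by (simp add: tri_of_nat add.commute)
  have "(\<lambda>n. real (n + 1) ^ 2 * inverse \<bar>z\<bar> ^ n * q ^ (n * (n + 1) div 2)) summable_on UNIV"
    by (rule summable_nonneg_imp_summable_on[OF summable_theta_nat]) (use assms in auto)
  then have "(\<lambda>n. 4 * inverse \<bar>z\<bar> * (real (n + 1) ^ 2 * inverse \<bar>z\<bar> ^ n * q ^ (n * (n + 1) div 2))) summable_on UNIV"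
    by (rule summable_on_cmult_right)
  then show "(\<lambda>n. (1 + \<bar>of_int (-1 - int n)\<bar>) ^ 2 * \<bar>z\<bar> powi (-1 - int n) * q powi tri (-1 - int n)) summable_on UNIV"
  proof (rule summable_on_comparison_test)
    fix n :: nat
    have p: "\<bar>z\<bar> powi (-1 - int n) = inverse \<bar>z\<bar> * inverse \<bar>z\<bar> ^ n"
      using power_int_minus[of "\<bar>z\<bar>" "int (Suc n)"]
      by (simp add: power_inverse del: of_nat_Suc) (simp add: algebra_simps)
    have "(1 + \<bar>of_int (-1 - int n)\<bar> :: real) ^ 2 \<le> 4 * real (n + 1) ^ 2"
      by (auto simp: power2_eq_square algebra_simps)
    then have "(1 + \<bar>of_int (-1 - int n)\<bar>) ^ 2 * (inverse \<bar>z\<bar> * inverse \<bar>z\<bar> ^ n * q ^ (n * (n + 1) div 2))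
      \<le> 4 * real (n + 1) ^ 2 * (inverse \<bar>z\<bar> * inverse \<bar>z\<bar> ^ n * q ^ (n * (n + 1) div 2))"
      by (rule mult_right_mono) (use assms in auto)
    then show "(1 + \<bar>of_int (-1 - int n)\<bar>) ^ 2 * \<bar>z\<bar> powi (-1 - int n) * q powi tri (-1 - int n)
       \<le> 4 * inverse \<bar>z\<bar> * (real (n + 1) ^ 2 * inverse \<bar>z\<bar> ^ n * q ^ (n * (n + 1) div 2))"
      unfolding p tri_reflect tri_of_nat power_int_of_nat by (simp add: mult_ac)
  qed (use assms in auto)
qed

section \<open>The Jacobi triple product\<close>

lemma qpoch_has_prod:
  fixes a q :: real
  assumes "\<bar>q\<bar> < 1"
  shows "(\<lambda>k. 1 - a * q ^ k) has_prod qpoch_inf a q"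
proof -
  have "summable (\<lambda>k. norm (a * q ^ k))"
    unfolding norm_mult norm_power by (intro summable_mult summable_geometric) (use assms in auto)
  then have "abs_convergent_prod (\<lambda>k. 1 - a * q ^ k)"
    by (intro summable_imp_abs_convergent_prod) (simp add: norm_minus_commute)
  then show ?thesis
    unfolding qpoch_inf_def by (intro convergent_prod_has_prod abs_convergent_prod_imp_convergent_prod)
qed

lemma qpoch_tendsto:
  fixes a q :: real
  assumes "\<bar>q\<bar> < 1"
  shows "(\<lambda>n. \<Prod>k<n. 1 - a * q ^ k) \<longlonglongrightarrow> qpoch_inf a q"
  by (rule has_prod_imp_tendsto'[OF qpoch_has_prod[OF assms]])

lemma qpoch_pos:
  fixes a q :: real
  assumes "\<bar>q\<bar> < 1" "\<bar>a\<bar> < 1"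
  shows "qpoch_inf a q > 0"
proof (rule has_prod_pos[OF qpoch_has_prod[OF assms(1)]])
  fix n
  have "\<bar>a * q ^ n\<bar> \<le> \<bar>a\<bar>"
    unfolding abs_mult power_abs
    using assms by (intro mult_right_le_one_le power_le_one) auto
  then show "1 - a * q ^ n > 0" using assms(2) by linarith
qed

section \<open>Central q-binomial coefficients\<close>

definition qfac :: "real \<Rightarrow> nat \<Rightarrow> real" where
  "qfac q n = (\<Prod>k<n. 1 - q ^ (k + 1))"

text \<open>With the value 0 at negative \<open>k\<close> the recursion 1/(q;q)_{k-1} = (1 -
  q^k)/(q;q)_k holds for every integer, \<open>k = 0\<close> included, so the q-binomial recurrence
  needs no boundary cases.\<close>

definition inv_qfac :: "real \<Rightarrow> int \<Rightarrow> real" where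
  "inv_qfac q k = (if k < 0 then 0 else 1 / qfac q (nat k))"

text \<open>Zero for \<open>\<bar>j\<bar> > n\<close>, so the finite triple product can be summed over all integers \<open>j\<close>.\<close>

definition qbin :: "real \<Rightarrow> nat \<Rightarrow> int \<Rightarrow> real" where
  "qbin q n j = qfac q (2 * n) * inv_qfac q (int n - j) * inv_qfac q (int n + j)"

context
  fixes q :: real
  assumes q0: "0 < q" and q1: "q < 1"
begin

lemma qpow_less_1: "q ^ (k + 1) < 1"
  using q0 q1 by (intro power_less_one_iff[THEN iffD2]) auto

lemma qfac_pos: "qfac q n > 0"
  unfolding qfac_def using qpow_less_1 by (intro prod_pos) simp

lemma qfac_le_1: "qfac q n \<le> 1"
  unfolding qfac_def using q0 less_imp_le[OF qpow_less_1] by (intro prod_le_1) simp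

lemma qfac_tendsto: "qfac q \<longlonglongrightarrow> qpoch_inf q q"
  using qpoch_tendsto[of q q] q0 q1 unfolding qfac_def by simp

lemma qpoch_self_pos: "qpoch_inf q q > 0"
  using qpoch_pos[of q q] q0 q1 by auto

lemma qfac_ge: "qfac q n \<ge> qpoch_inf q q"
proof (rule decseq_ge[OF _ qfac_tendsto])
  show "decseq (qfac q)"
    unfolding decseq_Suc_iff
  proof
    fix n
    show "qfac q (Suc n) \<le> qfac q n"
      using qfac_pos[of n] q0 q1 unfolding qfac_def
      using less_imp_le[OF qpow_less_1[of n]] by (simp add: mult_right_le_one_le)
  qed
qed

lemma inv_qfac_diff: "inv_qfac q (k - 1) = (1 - q powi k) * inv_qfac q k"
proof -
  consider "k < 0" | "k = 0" | "k > 0" by linarith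
  then show ?thesis
  proof cases
    case 3
    then obtain n where n: "k = int (Suc n)" by (metis gr0_implies_Suc zero_less_imp_eq_int)
    have "qfac q (Suc n) = qfac q n * (1 - q ^ Suc n)" by (simp add: qfac_def)
    moreover have "1 - q ^ Suc n \<noteq> 0" using qpow_less_1[of n] by simp
    ultimately have "1 / qfac q n = (1 - q ^ Suc n) * (1 / qfac q (Suc n))"
      using qfac_pos[of n] by simp
    then show ?thesis
      unfolding n inv_qfac_def power_int_of_nat nat_int by simp
  qed (auto simp: inv_qfac_def)
qed

lemma inv_qfac_bounds: "0 \<le> inv_qfac q k" "inv_qfac q k \<le> 1 / qpoch_inf q q"
  using qfac_pos[of "nat k"] qfac_ge[of "nat k"] qpoch_self_pos
  by (auto simp: inv_qfac_def intro!: divide_left_mono)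

lemma inv_qfac_tendsto:
  assumes "filterlim f at_top sequentially"
  shows "(\<lambda>n. inv_qfac q (f n)) \<longlonglongrightarrow> 1 / qpoch_inf q q"
proof -
  have "filterlim (\<lambda>n. nat (f n)) sequentially sequentially"
    by (rule filterlim_compose[OF filterlim_nat_sequentially assms])
  then have "(\<lambda>n. 1 / qfac q (nat (f n))) \<longlonglongrightarrow> 1 / qpoch_inf q q"
    using qpoch_self_pos by (intro tendsto_divide filterlim_compose[OF qfac_tendsto]) auto
  moreover have "eventually (\<lambda>n. f n \<ge> 0) sequentially"
    using assms by (simp add: filterlim_at_top)
  then have "eventually (\<lambda>n. 1 / qfac q (nat (f n)) = inv_qfac q (f n)) sequentially"
    by eventually_elim (auto simp: inv_qfac_def)
  ultimately show ?thesis by (rule Lim_transform_eventually)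
qed

lemma qbin_tendsto: "(\<lambda>n. qbin q n j) \<longlonglongrightarrow> 1 / qpoch_inf q q"
proof -
  have "filterlim (\<lambda>n. 2 * n :: nat) sequentially sequentially"
    by (intro filterlim_subseq) (auto simp: strict_mono_def)
  then have "(\<lambda>n. qfac q (2 * n)) \<longlonglongrightarrow> qpoch_inf q q"
    by (rule filterlim_compose[OF qfac_tendsto])
  moreover have shift: "filterlim (\<lambda>n. int n + i) at_top sequentially" for i
    unfolding filterlim_at_top
  proof
    fix Z
    show "\<forall>\<^sub>F n in sequentially. Z \<le> int n + i"
      by (rule eventually_sequentiallyI[of "nat (Z - i)"]) linarith
  qed
  moreover have "filterlim (\<lambda>n. int n - j) at_top sequentially"
    using shift[of "-j"] by simp
  ultimately have "(\<lambda>n. qbin q n j) \<longlonglongrightarrow> qpoch_inf q q * (1 / qpoch_inf q q) * (1 / qpoch_inf q q)"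
    unfolding qbin_def by (intro tendsto_mult inv_qfac_tendsto) auto
  then show ?thesis using qpoch_self_pos by simp
qed

lemma qbin_bounds: "0 \<le> qbin q n j" "qbin q n j \<le> (1 / qpoch_inf q q)\<^sup>2"
proof -
  show "0 \<le> qbin q n j"
    unfolding qbin_def using qfac_pos[of "2*n"] inv_qfac_bounds by (simp add: less_imp_le)
  have "qbin q n j \<le> 1 * (1 / qpoch_inf q q) * (1 / qpoch_inf q q)"
    unfolding qbin_def using qfac_pos[of "2*n"] inv_qfac_bounds qfac_le_1 qpoch_self_pos
    by (intro mult_mono) (auto simp: less_imp_le)
  then show "qbin q n j \<le> (1 / qpoch_inf q q)\<^sup>2" by (simp add: power2_eq_square)
qed

text \<open>Two steps of the q-Pascal rule, from row 2n to row 2n + 2. All terms are multiples of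
  \<open>qfac q (2 * n) * R * S\<close>, which turns the claim into a polynomial identity in
  \<open>a\<close> and \<open>b\<close>.\<close>

lemma qbin_Suc:
  "qbin q (Suc n) j = (1 + q ^ (2 * n + 1)) * qbin q n j
     + q powi (int n + 1 - j) * qbin q n (j - 1) + q powi (int n + 1 + j) * qbin q n (j + 1)"
proof -
  define a b R S where "a = q powi (int n + 1 - j)" and "b = q powi (int n + 1 + j)"
    and "R = inv_qfac q (int n + 1 - j)" and "S = inv_qfac q (int n + 1 + j)"
  have qa: "q powi (int n - j) = a / q" "q powi (int n + j) = b / q"
    using power_int_add_1[of q "int n - j"] power_int_add_1[of q "int n + j"] q0
    by (auto simp: a_def b_def algebra_simps)
  have ab: "a * b = q * q ^ (2 * n + 1)"
  proof -
    have "a * b = q powi (int (2 * n + 2))"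
      unfolding a_def b_def using q0 by (subst power_int_add[symmetric]) (auto simp: algebra_simps)
    then show ?thesis unfolding power_int_of_nat by simp
  qed
  have 1: "inv_qfac q (int n - j) = (1 - a) * R" "inv_qfac q (int n + j) = (1 - b) * S"
    using inv_qfac_diff[of "int n + 1 - j"] inv_qfac_diff[of "int n + 1 + j"]
    unfolding a_def b_def R_def S_def by (simp_all add: algebra_simps)
  have 2: "inv_qfac q (int n - (j + 1)) = (1 - a / q) * (1 - a) * R"
          "inv_qfac q (int n + (j - 1)) = (1 - b / q) * (1 - b) * S"
    using inv_qfac_diff[of "int n - j"] inv_qfac_diff[of "int n + j"]
    unfolding qa 1 by (simp_all add: diff_diff_eq add_diff_eq mult.assoc)
  have 3: "inv_qfac q (int n - (j - 1)) = R" "inv_qfac q (int n + (j + 1)) = S"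
    "inv_qfac q (int (Suc n) - j) = R" "inv_qfac q (int (Suc n) + j) = S"
    unfolding R_def S_def by (simp_all add: algebra_simps)
  have 4: "qfac q (2 * Suc n) = qfac q (2 * n) * (1 - q ^ (2 * n + 1)) * (1 - q * q ^ (2 * n + 1))"
    unfolding qfac_def by (simp add: mult.assoc)
  define e where "e = q ^ (2 * n + 1)"
  have ab': "a * b = q * e" using ab e_def by simp
  \<comment> \<open>This is not an identity in free variables: it holds because a b = q e, so
    \<open>a\<close> is eliminated first.\<close>
  have key: "(1 - e) * (1 - q * e) = (1 + e) * (1 - a) * (1 - b) + a * (1 - b / q) * (1 - b) + b * (1 - a / q) * (1 - a)"
  proof -
    have "a = q * e / b" using ab' q0 by (auto simp: field_simps b_def)
    moreover have "b \<noteq> 0" using q0 by (simp add: b_def)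
    ultimately show ?thesis using q0 by (simp add: divide_simps) algebra
  qed
  let ?K = "qfac q (2 * n) * R * S"
  have "?K * ((1 - e) * (1 - q * e)) = (1 + e) * (?K * ((1 - a) * (1 - b)))
      + a * (?K * ((1 - b / q) * (1 - b))) + b * (?K * ((1 - a / q) * (1 - a)))"
    unfolding key by (simp add: algebra_simps)
  then show ?thesis
    unfolding qbin_def 1 2 3 4 a_def[symmetric] b_def[symmetric] e_def[symmetric]
    by (simp only: mult_ac)
qed

end

section \<open>Sums over the integers under shifts and limits\<close>

lemma has_sum_int_shift:
  fixes f :: "int \<Rightarrow> 'a::topological_comm_monoid_add"
  assumes "(f has_sum s) UNIV"
  shows "((\<lambda>j. f (j + k)) has_sum s) UNIV"
proof -
  have "bij (\<lambda>j::int. j + k)" by (rule bij_plus_right)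
  from has_sum_reindex_bij_betw[OF this, of f s] show ?thesis using assms by simp
qed

lemma infsum_int_eq_suminf:
  fixes f :: "int \<Rightarrow> real"
  assumes "f summable_on UNIV"
  shows "infsum f UNIV = (\<Sum>n. f (int_decode n))" "summable (\<lambda>n. norm (f (int_decode n)))"
proof -
  have b: "bij_betw int_decode UNIV UNIV" by (rule bij_int_decode)
  have "((\<lambda>n. f (int_decode n)) has_sum infsum f UNIV) UNIV"
    using has_sum_reindex_bij_betw[OF b, of f] has_sum_infsum[OF assms] by blast
  from has_sum_imp_sums[OF this] show "infsum f UNIV = (\<Sum>n. f (int_decode n))"
    by (rule sums_unique)
  have "(\<lambda>j. norm (f j)) summable_on UNIV"
    by (rule summable_on_iff_abs_summable_on_real[THEN iffD1, OF assms])
  then have "(\<lambda>n. norm (f (int_decode n))) summable_on UNIV"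
    using summable_on_reindex_bij_betw[OF b, of "\<lambda>j. norm (f j)"] by blast
  then show "summable (\<lambda>n. norm (f (int_decode n)))" by (rule summable_on_imp_summable)
qed

text \<open>Tannery's theorem, transported from the natural numbers by \<open>int_decode\<close>.
  The limit \<open>l\<close> does not depend on \<open>j\<close>, as is the case for
  \<open>qbin\<close>, so it factors out of the sum.\<close>

lemma dominated_infsum_int:
  fixes w :: "int \<Rightarrow> real"
  assumes w: "w summable_on UNIV"
    and c: "\<And>n j. \<bar>c n j\<bar> \<le> B" "\<And>j. (\<lambda>n. c n j) \<longlonglongrightarrow> l"
  shows "(\<lambda>n. infsum (\<lambda>j. w j * c n j) UNIV) \<longlonglongrightarrow> infsum w UNIV * l"
proof -
  have aw: "(\<lambda>j. norm (w j)) summable_on UNIV"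
    by (rule summable_on_iff_abs_summable_on_real[THEN iffD1, OF w])
  have s: "(\<lambda>j. w j * c n j) summable_on UNIV" for n
  proof (rule abs_summable_summable, rule summable_on_comparison_test)
    show "(\<lambda>j. norm (w j) * B) summable_on UNIV" by (rule summable_on_cmult_left[OF aw])
  qed (auto simp: abs_mult c intro: mult_left_mono)
  have "(\<lambda>n. \<Sum>k. w (int_decode k) * c n (int_decode k)) \<longlonglongrightarrow> (\<Sum>k. w (int_decode k) * l)"
  proof (rule tannerys_theorem[THEN conjunct2, THEN conjunct2])
    show "(\<lambda>n. w (int_decode k) * c n (int_decode k)) \<longlonglongrightarrow> w (int_decode k) * l" for k
      by (intro tendsto_mult_left c)
    show "\<forall>\<^sub>F (k, n) in at_top \<times>\<^sub>F sequentially.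
       norm (w (int_decode k) * c n (int_decode k)) \<le> norm (w (int_decode k)) * B"
      by (intro always_eventually) (auto simp: abs_mult c intro: mult_left_mono)
    show "summable (\<lambda>k. norm (w (int_decode k)) * B)"
      by (intro summable_mult2 infsum_int_eq_suminf w)
  qed simp
  moreover have "(\<Sum>k. w (int_decode k) * l) = infsum w UNIV * l"
    using infsum_int_eq_suminf[OF w] by (simp add: suminf_mult2[OF summable_norm_cancel])
  ultimately show ?thesis by (simp add: infsum_int_eq_suminf[OF s])
qed

context
  fixes q :: real
  assumes q0: "0 < q" and q1: "q < 1"
begin

text \<open>The coefficients are those of 1, z and 1/z in
  \<open>(1 + z * q ^ (n + 1)) * (1 + q ^ n / z)\<close>, the two factors gained by the finite
  product. The shifts of \<open>tri\<close> absorb the dependence on \<open>j\<close> of the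
  coefficients in \<open>qbin_Suc\<close>.\<close>

lemma triple_term_Suc:
  assumes "z \<noteq> 0"
  shows "z powi j * q powi tri j * qbin q (Suc n) j =
    (1 + q ^ (2 * n + 1)) * (z powi j * q powi tri j * qbin q n j)
    + z * q ^ (n + 1) * (z powi (j - 1) * q powi tri (j - 1) * qbin q n (j - 1))
    + q ^ n / z * (z powi (j + 1) * q powi tri (j + 1) * qbin q n (j + 1))"
proof -
  have 1: "z powi (j - 1) = z powi j / z" "z powi (j + 1) = z powi j * z"
    using assms by (simp_all add: power_int_diff power_int_add)
  have 2: "q powi tri (j - 1) = q powi tri j / q powi j"
    "q powi tri (j + 1) = q powi tri j * q powi j * q"
    using q0 by (simp_all add: tri_diff tri_add power_int_diff power_int_add)
  have "q powi (int n + 1) = q ^ (n + 1)"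
    using power_int_of_nat[of q "n + 1"] by (simp add: add.commute)
  then have 3: "q powi (int n + 1 - j) = q ^ (n + 1) / q powi j"
    "q powi (int n + 1 + j) = q ^ (n + 1) * q powi j"
    using q0 by (subst power_int_diff power_int_add; simp)+
  have "q powi j > 0" "q ^ n > 0" using q0 by simp_all
  then show ?thesis
    unfolding qbin_Suc[OF q0 q1] 1 2 3 using assms q0 by (simp add: field_simps)
qed

lemma finite_triple_product:
  assumes "z \<noteq> 0"
  shows "((\<lambda>j. z powi j * q powi tri j * qbin q n j)
    has_sum (\<Prod>k<n. 1 + z * q ^ (k + 1)) * (\<Prod>k<n. 1 + q ^ k / z)) UNIV"
proof (induction n)
  case 0
  show ?case
    by (rule has_sum_finite_neutralI[of "{0}"]) (auto simp: qbin_def inv_qfac_def qfac_def tri_def)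
next
  case (Suc n)
  note IH = Suc.IH
  define P where "P = (\<Prod>k<n. 1 + z * q ^ (k + 1)) * (\<Prod>k<n. 1 + q ^ k / z)"
  have "(\<Prod>k<Suc n. 1 + z * q ^ (k + 1)) * (\<Prod>k<Suc n. 1 + q ^ k / z)
     = P * ((1 + z * q ^ (n + 1)) * (1 + q ^ n / z))"
    by (simp add: P_def mult_ac)
  also have "(1 + z * q ^ (n + 1)) * (1 + q ^ n / z) = 1 + q ^ (2 * n + 1) + z * q ^ (n + 1) + q ^ n / z"
    using assms by (simp add: field_simps power_add mult_2 mult_2_right)
  finally have s: "(\<Prod>k<Suc n. 1 + z * q ^ (k + 1)) * (\<Prod>k<Suc n. 1 + q ^ k / z)
     = (1 + q ^ (2 * n + 1)) * P + z * q ^ (n + 1) * P + q ^ n / z * P"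
    by (simp only: ring_distribs mult_ac)
  show ?case
    unfolding triple_term_Suc[OF assms] s
    using has_sum_int_shift[OF IH, of "-1"] has_sum_int_shift[OF IH, of 1]
    by (intro has_sum_add has_sum_cmult_right) (use IH in \<open>simp_all add: P_def\<close>)
qed

text \<open>This is z d/dz of the finite product at z = -1. The factor 1 + 1/z has a simple zero
  there, with z d/dz (1 + 1/z) = 1, so the remaining factors survive: \<open>qfac q (Suc n)\<close>
  from one product and \<open>qfac q n\<close> from the other.\<close>

lemma finite_triple_product_deriv:
  "((\<lambda>j. of_int j * ((-1) powi j * q powi tri j * qbin q (Suc n) j)) has_sum qfac q (Suc n) * qfac q n) UNIV"
proof -
  let ?f = "\<lambda>n j. (-1) powi j * q powi tri j * qbin q n j"
  \<comment> \<open>No derivative is taken: the recurrence is multiplied by \<open>j\<close>, and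
    writing j as (j - 1) + 1 or (j + 1) - 1 expresses the weighted sum through \<open>G\<close> and
    the unweighted sum \<open>F\<close>.\<close>
  have step: "((\<lambda>j. of_int j * ?f (Suc n) j) has_sum
      (1 + q ^ (2 * n + 1)) * G + (- (q ^ (n + 1))) * (G + F) + (- (q ^ n)) * (G - F)) UNIV"
    if G: "((\<lambda>j. of_int j * ?f n j) has_sum G) UNIV" and F: "((\<lambda>j. ?f n j) has_sum F) UNIV" for n G F
  proof -
    have e: "of_int j * ?f (Suc n) j = (1 + q ^ (2 * n + 1)) * (of_int j * ?f n j)
       + (- (q ^ (n + 1))) * (of_int (j + -1) * ?f n (j + -1) + ?f n (j + -1))
       + (- (q ^ n)) * (of_int (j + 1) * ?f n (j + 1) - ?f n (j + 1))" for j
    proof -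
      have "?f (Suc n) j = (1 + q ^ (2 * n + 1)) * ?f n j - q ^ (n + 1) * ?f n (j + -1) - q ^ n * ?f n (j + 1)"
        using triple_term_Suc[of "-1" j n] by simp
      moreover have "of_int j * (x * a - y * b - w * c)
        = x * (of_int j * a) + (- y) * (of_int (j + -1) * b + b) + (- w) * (of_int (j + 1) * c - c)"
        for x y w a b c :: real by (simp add: algebra_simps)
      ultimately show ?thesis by (simp only:)
    qed
    note G' = has_sum_int_shift[OF G] and F' = has_sum_int_shift[OF F]
    show ?thesis
      unfolding e
      using has_sum_add[OF has_sum_add[OF has_sum_cmult_right[OF G, of "1 + q ^ (2 * n + 1)"]
          has_sum_cmult_right[OF has_sum_add[OF G'[of "-1"] F'[of "-1"]], of "- (q ^ (n + 1))"]]
          has_sum_cmult_right[OF has_sum_add[OF G'[of 1] has_sum_uminusI[OF F'[of 1]]], of "- (q ^ n)"]]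
      by (simp only: add_uminus_conv_diff)
  qed
  show ?thesis
  proof (induction n)
    case 0
    \<comment> \<open>Only for the empty product is the unweighted sum 1; for every positive index
      the factor with k = 0 makes it 0.\<close>
    have "(?f 0 has_sum 1) UNIV" using finite_triple_product[of "-1" 0] by simp
    moreover have "((\<lambda>j. of_int j * ?f 0 j) has_sum 0) UNIV"
      by (rule has_sum_finite_neutralI[of "{}"]) (auto simp: qbin_def inv_qfac_def qfac_def)
    ultimately show ?case using step[of 0 0 1] by (simp add: qfac_def)
  next
    case (Suc n)
    have z: "(\<Prod>k<Suc n. 1 + q ^ k / (-1)) = 0"
      by (rule prod_zero) (auto intro: bexI[of _ 0])
    have "(?f (Suc n) has_sum 0) UNIV"
      using finite_triple_product[of "-1" "Suc n"] unfolding z by simp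
    note st = step[OF Suc.IH this]
    define a where "a = q ^ Suc n"
    have p: "q ^ (2 * Suc n + 1) = q * a * a" "q ^ (Suc n + 1) = q * a"
      by (simp_all add: a_def power_add mult_2)
    have "qfac q (Suc (Suc n)) * qfac q (Suc n)
       = ((1 - q * a) * (1 - a)) * (qfac q (Suc n) * qfac q n)"
      by (simp add: qfac_def a_def mult_ac)
    then have r: "(1 + q * a * a) * (qfac q (Suc n) * qfac q n) + (- (q * a)) * (qfac q (Suc n) * qfac q n + 0)
       + (- a) * (qfac q (Suc n) * qfac q n - 0) = qfac q (Suc (Suc n)) * qfac q (Suc n)"
      by (simp add: algebra_simps)
    show ?case
      using st unfolding p a_def[symmetric] r .
  qed
qed

lemma summable_theta_weight:
  assumes "z \<noteq> 0" and "\<And>j. \<bar>w j\<bar> \<le> K * (1 + \<bar>of_int j\<bar>) ^ 2"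
  shows "(\<lambda>j. w j * (z powi j * q powi tri j)) summable_on UNIV"
proof (rule abs_summable_summable, rule summable_on_comparison_test)
  show "(\<lambda>j. K * ((1 + \<bar>of_int j\<bar>) ^ 2 * \<bar>z\<bar> powi j * q powi tri j)) summable_on UNIV"
    by (intro summable_on_cmult_right summable_theta q0 q1 assms)
  fix j
  have "\<bar>w j\<bar> * (\<bar>z\<bar> powi j * q powi tri j) \<le> K * (1 + \<bar>of_int j\<bar>) ^ 2 * (\<bar>z\<bar> powi j * q powi tri j)"
    by (rule mult_right_mono[OF assms(2)]) (use q0 in auto)
  then show "norm (w j * (z powi j * q powi tri j)) \<le> K * ((1 + \<bar>of_int j\<bar>) ^ 2 * \<bar>z\<bar> powi j * q powi tri j)"
    using q0 by (simp add: abs_mult power_int_abs mult.assoc)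
qed auto

text \<open>Each \<open>qbin q (f n) j\<close> tends to 1/(q;q)_oo within a uniform bound, so a
  finite identity passes to the limit and gains the factor (q;q)_oo. The map \<open>f\<close>
  accommodates the index shift \<open>Suc\<close> of the derivative identity.\<close>

lemma infsum_theta_limit:
  assumes w: "w summable_on UNIV" and S: "\<And>n. ((\<lambda>j. w j * qbin q (f n) j) has_sum S n) UNIV"
    and f: "filterlim f at_top sequentially" and lim: "S \<longlonglongrightarrow> s"
  shows "(w has_sum s * qpoch_inf q q) UNIV"
proof -
  have E: "qpoch_inf q q > 0" by (rule qpoch_self_pos[OF q0 q1])
  have "(\<lambda>n. infsum (\<lambda>j. w j * qbin q (f n) j) UNIV) \<longlonglongrightarrow> infsum w UNIV * (1 / qpoch_inf q q)"
    by (rule dominated_infsum_int[OF w, where B = "(1 / qpoch_inf q q)\<^sup>2"])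
       (use qbin_bounds[OF q0 q1] in \<open>auto intro!: filterlim_compose[OF qbin_tendsto[OF q0 q1] f]\<close>)
  then have "S \<longlonglongrightarrow> infsum w UNIV * (1 / qpoch_inf q q)"
    by (simp add: infsumI[OF S])
  with lim have "s = infsum w UNIV * (1 / qpoch_inf q q)" by (rule LIMSEQ_unique)
  with E have "infsum w UNIV = s * qpoch_inf q q" by simp
  with has_sum_infsum[OF w] show ?thesis by simp
qed

theorem jacobi_triple_product:
  assumes z: "z \<noteq> 0"
  shows "((\<lambda>j. z powi j * q powi tri j) has_sum
     qpoch_inf q q * qpoch_inf (- (z * q)) q * qpoch_inf (- (1 / z)) q) UNIV"
proof -
  have "(\<lambda>j. 1 * (z powi j * q powi tri j)) summable_on UNIV"
    by (rule summable_theta_weight[where K = 1]) (auto simp: z power2_eq_square algebra_simps)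
  then have "(\<lambda>j. z powi j * q powi tri j) summable_on UNIV" by simp
  moreover have "(\<lambda>n. (\<Prod>k<n. 1 + z * q ^ (k + 1)) * (\<Prod>k<n. 1 + q ^ k / z)) \<longlonglongrightarrow>
    qpoch_inf (- (z * q)) q * qpoch_inf (- (1 / z)) q"
    using tendsto_mult[OF qpoch_tendsto[of q "- (z * q)"] qpoch_tendsto[of q "- (1 / z)"]] q0 q1
    by (simp add: mult.assoc)
  ultimately have "((\<lambda>j. z powi j * q powi tri j) has_sum
     qpoch_inf (- (z * q)) q * qpoch_inf (- (1 / z)) q * qpoch_inf q q) UNIV"
    by (rule infsum_theta_limit[OF _ finite_triple_product[OF z] filterlim_ident])
  then show ?thesis by (simp add: mult_ac)
qed

theorem jacobi_cube:
  "((\<lambda>j. of_int j * ((-1) powi j * q powi tri j)) has_sum qpoch_inf q q ^ 3) UNIV"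
proof -
  have "(\<lambda>j. of_int j * ((-1) powi j * q powi tri j)) summable_on UNIV"
    by (rule summable_theta_weight[where K = 1]) (auto simp: power2_eq_square algebra_simps)
  moreover have "(\<lambda>n. qfac q (Suc n) * qfac q n) \<longlonglongrightarrow> qpoch_inf q q * qpoch_inf q q"
    by (intro tendsto_mult LIMSEQ_Suc qfac_tendsto q0 q1)
  ultimately have "((\<lambda>j. of_int j * ((-1) powi j * q powi tri j)) has_sum
     qpoch_inf q q * qpoch_inf q q * qpoch_inf q q) UNIV"
    using finite_triple_product_deriv
    by (intro infsum_theta_limit[where f = Suc and S = "\<lambda>n. qfac q (Suc n) * qfac q n"])
       (auto simp: mult.assoc intro: filterlim_Suc)
  then show ?thesis by (simp add: power3_eq_cube)
qed

end

section \<open>Product formulas for theta functions\<close>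

lemma has_sum_product_real:
  fixes f g :: "int \<Rightarrow> real"
  assumes f: "(f has_sum a) UNIV" and g: "(g has_sum b) UNIV"
  shows "((\<lambda>(i, j). f i * g j) has_sum a * b) UNIV"
proof -
  have af: "(\<lambda>x. norm (f x)) summable_on UNIV" and ag: "(\<lambda>x. norm (g x)) summable_on UNIV"
    using f g summable_on_iff_abs_summable_on_real has_sum_imp_summable by blast+
  have "(\<lambda>x. norm (case x of (i, j) \<Rightarrow> f i * g j)) summable_on UNIV \<times> UNIV"
  proof (rule summable_on_SigmaI)
    show "((\<lambda>j. norm (case (i, j) of (i, j) \<Rightarrow> f i * g j)) has_sum norm (f i) * (\<Sum>\<^sub>\<infinity>x. norm (g x))) UNIV" for i
      by (simp add: abs_mult) (intro has_sum_cmult_right has_sum_infsum ag[simplified])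
    show "(\<lambda>i. norm (f i) * (\<Sum>\<^sub>\<infinity>x. norm (g x))) summable_on UNIV"
      by (intro summable_on_cmult_left af)
  qed auto
  then have s: "(\<lambda>(i, j). f i * g j) summable_on UNIV \<times> UNIV"
    by (rule abs_summable_summable)
  have "((\<lambda>(i, j). f i * g j) has_sum a * b) (UNIV \<times> UNIV)"
    by (rule has_sum_SigmaI[OF _ has_sum_cmult_left[OF f, of b] s])
       (auto intro: has_sum_cmult_right[OF g])
  then show ?thesis by simp
qed

section \<open>Rotation of a planar lattice and its two parity cosets\<close>

lemma has_sum_int2_parity:
  fixes f :: "int \<times> int \<Rightarrow> real"
  assumes "(f has_sum a) {(n, m). even (n + m)}" "(f has_sum b) {(n, m). odd (n + m)}"
  shows "(f has_sum (a + b)) UNIV"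
proof -
  have "UNIV = {(n, m). even (n + m)} \<union> {(n, m). odd (n + m :: int)}" by auto
  then show ?thesis
    using has_sum_Un_disjoint[OF assms] by auto
qed

lemma has_sum_even_iff:
  fixes f :: "int \<times> int \<Rightarrow> real"
  shows "((\<lambda>(i, j). f (i + j, i - j)) has_sum s) UNIV \<longleftrightarrow> (f has_sum s) {(n, m). even (n + m)}"
proof -
  have "(n + m) div 2 + (n - m) div 2 = n \<and> (n + m) div 2 - (n - m) div 2 = m"
    if "even (n + m)" for n m :: int using that by presburger
  then show ?thesis
    by (intro has_sum_reindex_bij_witness[where i = "\<lambda>(n, m). ((n + m) div 2, (n - m) div 2)"
        and j = "\<lambda>(i, j). (i + j, i - j)"]) auto
qed

lemma has_sum_odd_iff:
  fixes f :: "int \<times> int \<Rightarrow> real"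
  shows "((\<lambda>(i, j). f (i + j + 1, i - j)) has_sum s) UNIV \<longleftrightarrow> (f has_sum s) {(n, m). odd (n + m)}"
proof -
  have "(n + m) div 2 + (n - m) div 2 + 1 = n \<and> (n + m) div 2 - (n - m) div 2 = m"
    if "odd (n + m)" for n m :: int using that by presburger
  moreover have "(i + j + 1 + (i - j)) div 2 = i \<and> (i + j + 1 - (i - j)) div 2 = j" for i j :: int
    by presburger
  ultimately show ?thesis
    by (intro has_sum_reindex_bij_witness[where i = "\<lambda>(n, m). ((n + m) div 2, (n - m) div 2)"
        and j = "\<lambda>(i, j). (i + j + 1, i - j)"]) auto
qed

section \<open>Changing the base of infinite products\<close>

lemma qpoch_split:
  fixes a q :: real
  assumes "\<bar>q\<bar> < 1"
  shows "qpoch_inf a q = qpoch_inf a (q\<^sup>2) * qpoch_inf (a * q) (q\<^sup>2)"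
proof -
  have q2: "\<bar>q\<^sup>2\<bar> < 1" using assms by (simp add: abs_square_less_1)
  have "(\<Prod>k<2 * n. 1 - a * q ^ k) = (\<Prod>k<n. 1 - a * (q\<^sup>2) ^ k) * (\<Prod>k<n. 1 - a * q * (q\<^sup>2) ^ k)" for n
    by (induction n) (auto simp: power_mult[symmetric] mult_ac)
  then have "(\<lambda>n. \<Prod>k<2 * n. 1 - a * q ^ k) \<longlonglongrightarrow> qpoch_inf a (q\<^sup>2) * qpoch_inf (a * q) (q\<^sup>2)"
    using tendsto_mult[OF qpoch_tendsto[OF q2, of a] qpoch_tendsto[OF q2, of "a * q"]] by simp
  moreover have "(\<lambda>n. \<Prod>k<2 * n. 1 - a * q ^ k) \<longlonglongrightarrow> qpoch_inf a q"
    by (rule filterlim_compose[OF qpoch_tendsto[OF assms]])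
       (auto intro!: filterlim_subseq simp: strict_mono_def)
  ultimately show ?thesis by (rule LIMSEQ_unique[symmetric])
qed

lemma qpoch_mult_minus:
  fixes a q :: real
  assumes "\<bar>q\<bar> < 1"
  shows "qpoch_inf a q * qpoch_inf (- a) q = qpoch_inf (a\<^sup>2) (q\<^sup>2)"
proof -
  have q2: "\<bar>q\<^sup>2\<bar> < 1" using assms by (simp add: abs_square_less_1)
  have "(\<Prod>k<n. 1 - a * q ^ k) * (\<Prod>k<n. 1 - (- a) * q ^ k) = (\<Prod>k<n. 1 - a\<^sup>2 * (q\<^sup>2) ^ k)" for n
    unfolding prod.distrib[symmetric]
    by (intro prod.cong) (auto simp: algebra_simps power2_eq_square power_mult_distrib)
  then have "(\<lambda>n. \<Prod>k<n. 1 - a\<^sup>2 * (q\<^sup>2) ^ k) \<longlonglongrightarrow> qpoch_inf a q * qpoch_inf (- a) q"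
    using tendsto_mult[OF qpoch_tendsto[OF assms, of a] qpoch_tendsto[OF assms, of "- a"]] by simp
  then show ?thesis using qpoch_tendsto[OF q2, of "a\<^sup>2"] by (rule LIMSEQ_unique)
qed

abbreviation euler_fun :: "real \<Rightarrow> real" where "euler_fun q \<equiv> qpoch_inf q q"

lemma euler_fun_eq_chi:
  fixes q :: real
  assumes "\<bar>q\<bar> < 1"
  shows "euler_fun q = theta_chi (- q) * euler_fun (q\<^sup>2)"
  using qpoch_split[OF assms, of q] by (simp add: theta_chi_def power2_eq_square)

lemma theta_chi_mult_minus:
  fixes q :: real
  assumes "\<bar>q\<bar> < 1"
  shows "theta_chi q * theta_chi (- q) = theta_chi (- (q\<^sup>2))"
  using qpoch_mult_minus[of "q\<^sup>2" "-q"] assms by (simp add: theta_chi_def abs_square_less_1)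

lemma theta_chi_pos:
  fixes q :: real
  assumes "\<bar>q\<bar> < 1"
  shows "theta_chi q > 0"
  unfolding theta_chi_def using assms by (intro qpoch_pos) (auto simp: abs_square_less_1)

context
  fixes q :: real
  assumes q0: "q \<noteq> 0" and q1: "\<bar>q\<bar> < 1"
begin

lemma even_power_bounds:
  assumes "k > 0"
  shows "0 < q ^ (2 * k)" "q ^ (2 * k) < 1"
proof -
  have "\<bar>q\<bar> ^ (2 * k) < 1" using assms q1 by (intro power_less_one_iff[THEN iffD2]) auto
  then show "0 < q ^ (2 * k)" "q ^ (2 * k) < 1" using q0 by (simp_all add: power_mult)
qed

lemma theta_phi_has_sum: "((\<lambda>j. q powi (j\<^sup>2)) has_sum theta_phi q) UNIV"
  and theta_phi_eq: "theta_phi q = euler_fun (q\<^sup>2) * theta_chi q ^ 2"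
proof -
  have e: "(1 / q) powi j * (q\<^sup>2) powi tri j = q powi (j\<^sup>2)" for j
  proof -
    have "(1 / q) powi j * (q\<^sup>2) powi tri j = q powi (2 * tri j - j)"
      using q0 by (simp add: power_int_power power_int_diff power_int_one_over)
    also have "2 * tri j - j = j\<^sup>2" using two_tri[of j] by (simp add: power2_eq_square algebra_simps)
    finally show ?thesis .
  qed
  have *: "((\<lambda>j. q powi (j\<^sup>2)) has_sum euler_fun (q\<^sup>2) * theta_chi q ^ 2) UNIV"
    using jacobi_triple_product[of "q\<^sup>2" "1 / q"] even_power_bounds[of 1] q0
    unfolding e by (simp add: theta_chi_def power2_eq_square mult.assoc)
  from infsumI[OF *] show "theta_phi q = euler_fun (q\<^sup>2) * theta_chi q ^ 2"
    by (simp add: theta_phi_def)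
  with * show "((\<lambda>j. q powi (j\<^sup>2)) has_sum theta_phi q) UNIV" by simp
qed

lemma theta_psi_has_sum_nat: "((\<lambda>n. q ^ (n * (n + 1) div 2)) has_sum theta_psi q) UNIV"
proof -
  have s: "summable (\<lambda>n. norm (q ^ (n * (n + 1) div 2)))"
  proof (rule summable_comparison_test')
    show "summable (\<lambda>n. \<bar>q\<bar> ^ n)" using q1 by simp
    fix n :: nat
    have "n \<le> n * (n + 1) div 2" by (cases n) auto
    then show "norm (norm (q ^ (n * (n + 1) div 2))) \<le> \<bar>q\<bar> ^ n"
      using q1 by (simp add: power_abs power_decreasing)
  qed
  show ?thesis
    unfolding theta_psi_def
    by (rule norm_summable_imp_has_sum[OF s summable_sums[OF summable_norm_cancel[OF s]]])
qed

text \<open>The triangular numbers with index n = 2 j and n = -2 j - 1 are both 2 j^2 + j, for j >=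
  0 and j < 0 respectively. A sum over all integers is needed for the triple product and for lattice
  arguments.\<close>

lemma theta_psi_has_sum: "((\<lambda>j. q powi (2 * j\<^sup>2 + j)) has_sum theta_psi q) UNIV"
proof -
  have "((\<lambda>n. q powi tri (int n)) has_sum theta_psi q) UNIV"
    using theta_psi_has_sum_nat by (simp add: tri_of_nat)
  moreover have "((\<lambda>j. q powi (2 * j\<^sup>2 + j)) has_sum theta_psi q) UNIV \<longleftrightarrow>
     ((\<lambda>n. q powi tri (int n)) has_sum theta_psi q) UNIV"
  proof -
    define J where "J j = (if j \<ge> 0 then nat (2 * j) else nat (- 2 * j - 1))" for j :: int
    define I where "I n = (if even n then int n div 2 else - ((int n + 1) div 2))" for n
    have J: "int (J j) = (if j \<ge> 0 then 2 * j else - 2 * j - 1)" for j by (simp add: J_def)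
    have I: "I n = (if even (int n) then int n div 2 else - ((int n + 1) div 2))" for n
      by (simp add: I_def)
    show ?thesis
    proof (rule has_sum_reindex_bij_witness[where j = J and i = I])
      show "I (J j) = j" for j unfolding I J by presburger
      have "int (J (I n)) = int n" for n unfolding I J by presburger
      then show "J (I n) = n" for n by (simp only: of_nat_eq_iff)
      fix j :: int
      have "tri (int (J j)) = 2 * j\<^sup>2 + j"
        using two_tri[of "2 * j"] two_tri[of "- 2 * j - 1"] unfolding J
        by (auto simp: power2_eq_square algebra_simps)
      then show "q powi tri (int (J j)) = q powi (2 * j\<^sup>2 + j)"
        by simp
    qed auto
  qed
  ultimately show ?thesis by blast
qed

lemma theta_psi_eq: "theta_psi q = euler_fun (q ^ 4) * theta_chi q"
proof -
  have e: "(1 / q) powi j * (q ^ 4) powi tri j = q powi (2 * j\<^sup>2 + j)" for j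
  proof -
    have "(1 / q) powi j * (q ^ 4) powi tri j = q powi (4 * tri j - j)"
      using q0 by (simp add: power_int_power power_int_diff power_int_one_over)
    also have "4 * tri j - j = 2 * j\<^sup>2 + j" using two_tri[of j] by (simp add: power2_eq_square algebra_simps)
    finally show ?thesis .
  qed
  have "theta_psi q = euler_fun (q ^ 4) * qpoch_inf (- (q ^ 3)) (q ^ 4) * qpoch_inf (- q) (q ^ 4)"
    using jacobi_triple_product[of "q ^ 4" "1 / q"] even_power_bounds[of 2] q0 theta_psi_has_sum
    unfolding e by (simp add: has_sum_unique power_numeral_reduce)
  moreover have "theta_chi q = qpoch_inf (- q) (q ^ 4) * qpoch_inf (- (q ^ 3)) (q ^ 4)"
  proof -
    have "\<bar>q\<^sup>2\<bar> < 1" using q1 by (simp add: abs_square_less_1)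
    from qpoch_split[OF this, of "- q"] show ?thesis
      by (simp add: theta_chi_def power_numeral_reduce mult_ac)
  qed
  ultimately show ?thesis by simp
qed

end

text \<open>The reflection j -> -1 - j doubles the one-sided series. Exponents of this shape are
  what the odd coset leaves in \<open>theta_phi_sq\<close>.\<close>

lemma theta_psi_sq_has_sum:
  fixes q :: real
  assumes q0: "q \<noteq> 0" and q1: "\<bar>q\<bar> < 1"
  shows "((\<lambda>j. q powi (j\<^sup>2 + j)) has_sum 2 * theta_psi (q\<^sup>2)) UNIV"
proof -
  have q2: "q\<^sup>2 \<noteq> 0" "\<bar>q\<^sup>2\<bar> < 1" using q0 q1 by (auto simp: abs_square_less_1)
  have n: "(q\<^sup>2) ^ (n * (n + 1) div 2) = q powi ((int n)\<^sup>2 + int n)" for n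
  proof -
    have "(q\<^sup>2) ^ (n * (n + 1) div 2) = q ^ (n * n + n)"
      by (simp add: power_mult[symmetric] even_mult_iff add.commute)
    then show ?thesis by (metis (no_types) of_nat_add of_nat_mult power2_eq_square power_int_of_nat)
  qed
  have e: "(-1 - int n)\<^sup>2 + (-1 - int n) = (int n)\<^sup>2 + int n" for n
    by (simp add: power2_eq_square algebra_simps)
  have "((\<lambda>j. q powi (j\<^sup>2 + j)) has_sum theta_psi (q\<^sup>2) + theta_psi (q\<^sup>2)) UNIV"
  proof (rule has_sum_int_split)
    show "((\<lambda>n. q powi ((int n)\<^sup>2 + int n)) has_sum theta_psi (q\<^sup>2)) UNIV"
      using theta_psi_has_sum_nat[OF q2] unfolding n .
    then show "((\<lambda>n. q powi ((-1 - int n)\<^sup>2 + (-1 - int n))) has_sum theta_psi (q\<^sup>2)) UNIV"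
      unfolding e .
  qed
  then show ?thesis by simp
qed

section \<open>Lattice identities\<close>

lemma theta_phi_sq:
  fixes q :: real
  assumes "q \<noteq> 0" "\<bar>q\<bar> < 1"
  shows "theta_phi q ^ 2 = theta_phi (q\<^sup>2) ^ 2 + 4 * q * theta_psi (q ^ 4) ^ 2"
proof -
  have q2: "q\<^sup>2 \<noteq> 0" "\<bar>q\<^sup>2\<bar> < 1" using assms by (auto simp: abs_square_less_1)
  have *: "((\<lambda>(n, m). q powi (n\<^sup>2) * q powi (m\<^sup>2)) has_sum theta_phi q * theta_phi q) UNIV"
    by (intro has_sum_product_real theta_phi_has_sum assms)
  have ev: "((\<lambda>(n, m). q powi (n\<^sup>2) * q powi (m\<^sup>2)) has_sum theta_phi (q\<^sup>2) * theta_phi (q\<^sup>2)) {(n, m). even (n + m)}"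
  proof -
    have e: "(\<lambda>(i, j). (q\<^sup>2) powi (i\<^sup>2) * (q\<^sup>2) powi (j\<^sup>2))
        = (\<lambda>(i, j). (\<lambda>(n, m). q powi (n\<^sup>2) * q powi (m\<^sup>2)) (i + j, i - j))"
    proof (intro ext, clarify)
      fix i j :: int
      have "(i + j)\<^sup>2 + (i - j)\<^sup>2 = 2 * i\<^sup>2 + 2 * j\<^sup>2"
        by (simp add: power2_eq_square algebra_simps)
      then have "q powi ((i + j)\<^sup>2) * q powi ((i - j)\<^sup>2) = q powi (2 * i\<^sup>2) * q powi (2 * j\<^sup>2)"
        using assms by (simp add: power_int_add[symmetric])
      then show "(q\<^sup>2) powi (i\<^sup>2) * (q\<^sup>2) powi (j\<^sup>2) = q powi ((i + j)\<^sup>2) * q powi ((i - j)\<^sup>2)"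
        by (simp add: power_int_power)
    qed
    show ?thesis
      using has_sum_product_real[OF theta_phi_has_sum[OF q2] theta_phi_has_sum[OF q2]]
      unfolding e has_sum_even_iff .
  qed
  have od: "((\<lambda>(n, m). q powi (n\<^sup>2) * q powi (m\<^sup>2)) has_sum
      q * ((2 * theta_psi ((q\<^sup>2)\<^sup>2)) * (2 * theta_psi ((q\<^sup>2)\<^sup>2)))) {(n, m). odd (n + m)}"
  proof -
    have "q * (case x of (i, j) \<Rightarrow> (q\<^sup>2) powi (i\<^sup>2 + i) * (q\<^sup>2) powi (j\<^sup>2 + j))
        = (case x of (i, j) \<Rightarrow> (\<lambda>(n, m). q powi (n\<^sup>2) * q powi (m\<^sup>2)) (i + j + 1, i - j))" for x
    proof (cases x)
      case (Pair i j)
      have "(i + j + 1)\<^sup>2 + (i - j)\<^sup>2 = 2 * (i\<^sup>2 + i) + 2 * (j\<^sup>2 + j) + 1"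
        by (simp add: power2_eq_square algebra_simps)
      then have "q powi ((i + j + 1)\<^sup>2) * q powi ((i - j)\<^sup>2) = q powi (2 * (i\<^sup>2 + i)) * q powi (2 * (j\<^sup>2 + j)) * q"
        using assms by (simp add: power_int_add[symmetric] power_int_add_1[symmetric])
      then show ?thesis by (simp add: Pair power_int_power)
    qed
    with has_sum_cmult_right[OF has_sum_product_real[OF theta_psi_sq_has_sum[OF q2] theta_psi_sq_has_sum[OF q2]], of q]
    show ?thesis unfolding has_sum_odd_iff[symmetric] by simp
  qed
  have "theta_phi q * theta_phi q = theta_phi (q\<^sup>2) * theta_phi (q\<^sup>2)
      + q * ((2 * theta_psi ((q\<^sup>2)\<^sup>2)) * (2 * theta_psi ((q\<^sup>2)\<^sup>2)))"
    by (rule has_sum_unique[OF * has_sum_int2_parity[OF ev od]])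
  then show ?thesis by (simp add: power2_eq_square power_numeral_reduce mult_ac)
qed

text \<open>8 e + 8 = (4n + 1)^2 + 7 (4m + 1)^2 is a norm from Q(sqrt(-7)). The left side keeps the
  odd exponents only, and the lattice points carrying them are, up to sign, the products of all
  lattice points with (1 + sqrt(-7))/2. Its norm is 2, whence the odd exponents are 2 e + 1.\<close>

lemma theta_psi_degree7:
  fixes q :: real
  assumes "0 < q" "q < 1"
  shows "theta_psi q * theta_psi (q ^ 7) - theta_psi (- q) * theta_psi (- (q ^ 7))
     = 2 * q * theta_psi (q\<^sup>2) * theta_psi (q ^ 14)"
proof -
  define e :: "int \<times> int \<Rightarrow> int" where "e = (\<lambda>(n, m). (2 * n\<^sup>2 + n) + 7 * (2 * m\<^sup>2 + m))"
  have psi: "((\<lambda>j. x powi (2 * j\<^sup>2 + j)) has_sum theta_psi x) UNIV" if "x \<noteq> 0" "\<bar>x\<bar> < 1" for x :: real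
    by (rule theta_psi_has_sum[OF that])
  have prod: "((\<lambda>p. x powi (e p)) has_sum theta_psi x * theta_psi (x ^ 7)) UNIV"
    if x: "x \<noteq> 0" "\<bar>x\<bar> < 1" for x :: real
  proof -
    have x7: "x ^ 7 \<noteq> 0" "\<bar>x ^ 7\<bar> < 1"
      using x by (auto simp: power_abs power_less_one_iff)
    have "(\<lambda>p. x powi (e p)) = (\<lambda>(n, m). x powi (2 * n\<^sup>2 + n) * (x ^ 7) powi (2 * m\<^sup>2 + m))"
      using x by (auto simp: e_def power_int_power power_int_add)
    with has_sum_product_real[OF psi[OF x] psi[OF x7]] show ?thesis by simp
  qed
  let ?A = "{(n, m). odd (n + m :: int)}"
  have even_e: "even (e (n, m)) \<longleftrightarrow> even (n + m)" for n m
    by (simp add: e_def)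
  have l1: "((\<lambda>p. q powi (e p) - (- q) powi (e p)) has_sum
      theta_psi q * theta_psi (q ^ 7) - theta_psi (- q) * theta_psi (- (q ^ 7))) UNIV"
    using has_sum_add[OF prod[of q] has_sum_uminusI[OF prod[of "- q"]]] assms by simp
  have "((\<lambda>p. 2 * q powi (e p)) has_sum
      theta_psi q * theta_psi (q ^ 7) - theta_psi (- q) * theta_psi (- (q ^ 7))) ?A"
    by (rule has_sum_cong_neutral[THEN iffD1, OF _ _ _ l1]) (auto simp: power_int_minus_left even_e dest: arg_cong[of _ 0 even])
  moreover have "((\<lambda>p. 2 * q powi (e p)) has_sum 2 * q * theta_psi (q\<^sup>2) * theta_psi (q ^ 14)) ?A"
  proof -
    have q2: "q\<^sup>2 \<noteq> 0" "\<bar>q\<^sup>2\<bar> < 1" using assms by (auto simp: abs_square_less_1)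
    have "((\<lambda>p. 2 * q * (q\<^sup>2) powi (e p)) has_sum 2 * q * (theta_psi (q\<^sup>2) * theta_psi ((q\<^sup>2) ^ 7))) UNIV"
      by (intro has_sum_cmult_right prod q2)
    moreover have "((\<lambda>p. 2 * q * (q\<^sup>2) powi (e p)) has_sum s) UNIV \<longleftrightarrow> ((\<lambda>p. 2 * q powi (e p)) has_sum s) ?A" for s
    proof -
      \<comment> \<open>Multiplication of N + M sqrt(-7) by (1 + sqrt(-7))/2, where N = 4i + 1 and M
        = 4j + 1. For odd i + j both new coordinates are 3 mod 4, and the product is negated to
        bring them back to 1 mod 4.\<close>
      define J where "J = (\<lambda>(i, j). if even (i + j) then ((i - 7 * j - 2) div 2, (i + j) div 2)
                 else ((7 * j + 1 - i) div 2, - ((i + j + 1) div 2)) :: int \<times> int)"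
      \<comment> \<open>Multiplication by the inverse element (1 - sqrt(-7))/4. The new second
        coordinate is m - n, so its residue mod 4 decides about the sign.\<close>
      define I where "I = (\<lambda>(n, m). if (m - n) mod 4 = 1 then ((n + 7 * m + 1) div 4, (m - n - 1) div 4)
                 else (- ((n + 7 * m + 3) div 4), (n - m - 1) div 4) :: int \<times> int)"
      have J: "e (J p) = 2 * e p + 1 \<and> I (J p) = p \<and> J p \<in> ?A" for p
      proof -
        obtain i j where p: "p = (i, j)" by (cases p)
        consider k where "i = 2 * k - j" | k where "i = 2 * k + 1 - j"
          by (metis add_diff_cancel_right' evenE oddE)
        then show ?thesis
        proof cases
          case 1
          have "(i - 7 * j - 2) div 2 = k - 4 * j - 1" "(i + j) div 2 = k" "even (i + j)"
            unfolding 1 by presburger+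
          then have Jp: "J p = (k - 4 * j - 1, k)" by (simp add: J_def p)
          have "(k - (k - 4 * j - 1)) mod 4 = 1" "((k - 4 * j - 1) + 7 * k + 1) div 4 = i"
            "(k - (k - 4 * j - 1) - 1) div 4 = j" "odd (k - 4 * j - 1 + k)"
            unfolding 1 by presburger+
          then have "I (k - 4 * j - 1, k) = p" "(k - 4 * j - 1, k) \<in> ?A" by (simp_all add: I_def p)
          moreover have "e (k - 4 * j - 1, k) = 2 * e p + 1"
            by (simp add: e_def p 1 power2_eq_square algebra_simps)
          ultimately show ?thesis by (simp only: Jp)
        next
          case 2
          have "(7 * j + 1 - i) div 2 = 4 * j - k" "(i + j + 1) div 2 = k + 1" "odd (i + j)"
            unfolding 2 by presburger+
          then have Jp: "J p = (4 * j - k, - (k + 1))" by (simp add: J_def p)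
          have "(- (k + 1) - (4 * j - k)) mod 4 \<noteq> 1" "- (((4 * j - k) + 7 * (- (k + 1)) + 3) div 4) = i"
            "((4 * j - k) - (- (k + 1)) - 1) div 4 = j" "odd (4 * j - k + - (k + 1))"
            unfolding 2 by presburger+
          then have "I (4 * j - k, - (k + 1)) = p" "(4 * j - k, - (k + 1)) \<in> ?A" by (simp_all add: I_def p)
          moreover have "e (4 * j - k, - (k + 1)) = 2 * e p + 1"
            by (simp add: e_def p 2 power2_eq_square algebra_simps)
          ultimately show ?thesis by (simp only: Jp)
        qed
      qed
      have I: "J (I p) = p" if p: "p \<in> ?A" for p
      proof -
        obtain n m where nm: "p = (n, m)" by (cases p)
        with p have "odd (m - n)" by auto
        then consider k where "n = m - 4 * k - 1" | k where "n = m - 4 * k - 3"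
        proof -
          have "m - n = 4 * ((m - n) div 4) + 1 \<or> m - n = 4 * ((m - n) div 4) + 3"
            using \<open>odd (m - n)\<close> by presburger
          then show ?thesis
          proof
            assume "m - n = 4 * ((m - n) div 4) + 1"
            then show ?thesis by (intro that(1)[of "(m - n) div 4"]) linarith
          next
            assume "m - n = 4 * ((m - n) div 4) + 3"
            then show ?thesis by (intro that(2)[of "(m - n) div 4"]) linarith
          qed
        qed
        then show ?thesis
        proof cases
          case 1
          have "(m - n) mod 4 = 1" "(n + 7 * m + 1) div 4 = 2 * m - k" "(m - n - 1) div 4 = k"
            unfolding 1 by presburger+
          then have "I p = (2 * m - k, k)" by (simp add: I_def nm)
          moreover have "even (2 * m - k + k)" "(2 * m - k - 7 * k - 2) div 2 = n" "(2 * m - k + k) div 2 = m"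
            unfolding 1 by presburger+
          ultimately show ?thesis by (simp add: J_def nm)
        next
          case 2
          have "(m - n) mod 4 \<noteq> 1" "(n + 7 * m + 3) div 4 = 2 * m - k" "(n - m - 1) div 4 = - k - 1"
            unfolding 2 by presburger+
          then have "I p = (k - 2 * m, - k - 1)" by (simp add: I_def nm)
          moreover have "odd (k - 2 * m + (- k - 1))" "(7 * (- k - 1) + 1 - (k - 2 * m)) div 2 = n"
            "- ((k - 2 * m + (- k - 1) + 1) div 2) = m"
            unfolding 2 by presburger+
          ultimately show ?thesis by (simp add: J_def nm)
        qed
      qed
      show ?thesis
      proof (rule has_sum_reindex_bij_witness[where j = J and i = I])
        fix p :: "int \<times> int"
        show "I (J p) = p" "J p \<in> ?A" using J[of p] by simp_all
        have "q powi (2 * e p + 1) = q * (q\<^sup>2) powi e p"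
          using assms by (simp add: power_int_add power_int_power)
        then show "2 * q powi e (J p) = 2 * q * (q\<^sup>2) powi e p" using J by simp
      qed (use I in auto)
    qed
    ultimately show ?thesis by (simp add: power_mult[symmetric] mult.assoc)
  qed
  ultimately show ?thesis by (rule has_sum_unique)
qed

section \<open>The logarithmic derivative of theta quotients\<close>

text \<open>Termwise differentiation by the Weierstrass M-test. The parameter \<open>k\<close>
  treats both series of the Wronskian at once: \<open>k = 0\<close> has exponents j^2 + j and
  \<open>k = 1\<close> has exponents j^2.\<close>

lemma theta_series_deriv:
  fixes q :: real and k :: int
  assumes q: "0 < q" "q < 1"
  defines "e \<equiv> \<lambda>j. 2 * tri j - k * j"
  assumes e_nonneg: "\<And>j. e j \<ge> 0"
  obtains D where "((\<lambda>x. \<Sum>\<^sub>\<infinity>j. x powi e j) has_real_derivative D) (at q)"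
    "((\<lambda>j. of_int (e j) * q powi e j) has_sum q * D) UNIV"
proof -
  have pw: "x powi e j = (x powi (- k)) powi j * (x\<^sup>2) powi tri j" if "x > 0" for x :: real and j
  proof -
    have e: "e j = (- k) * j + 2 * tri j" by (simp add: e_def)
    have "x powi e j = x powi ((- k) * j) * x powi (2 * tri j)"
      unfolding e using that by (subst power_int_add) auto
    then show ?thesis by (simp only: power_int_mult) (simp add: power_int_mult)
  qed
  have sum_w: "(\<lambda>j. w j * x powi e j) summable_on UNIV"
    if "0 < x" "x < 1" "\<And>j. \<bar>w j\<bar> \<le> K * (1 + \<bar>of_int j\<bar>) ^ 2" for x K :: real and w
    unfolding pw[OF that(1)]
    by (rule summable_theta_weight[OF _ _ _ that(3)]) (use that in \<open>auto simp: abs_square_less_1 power_less_one_iff\<close>)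
  have sum_1: "(\<lambda>j. x powi e j) summable_on UNIV" if "0 < x" "x < 1" for x :: real
    using sum_w[OF that, of "\<lambda>_. 1" 1] by (simp add: power2_eq_square algebra_simps)
  have sum_e: "(\<lambda>j. of_int (e j) * x powi e j) summable_on UNIV" if "0 < x" "x < 1" for x :: real
  proof (rule sum_w[OF that])
    fix j :: int
    define a where "a = \<bar>real_of_int j\<bar>"
    have "real_of_int (e j) = of_int (j * (j + 1)) - of_int k * of_int j"
      unfolding e_def two_tri by simp
    also have "\<dots> = a\<^sup>2 + (1 - of_int k) * of_int j"
      by (simp add: a_def power2_eq_square algebra_simps)
    also have "(1 - of_int k) * of_int j \<le> \<bar>(1 - of_int k) * of_int j :: real\<bar>" by simp
    also have "\<dots> \<le> (1 + \<bar>of_int k\<bar>) * a"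
      unfolding abs_mult a_def by (rule mult_right_mono) auto
    finally have "real_of_int (e j) \<le> a\<^sup>2 + (1 + \<bar>of_int k\<bar>) * a" by simp
    also have "\<dots> \<le> (1 + \<bar>of_int k\<bar>) * (1 + a) ^ 2"
    proof -
      have "0 \<le> a" "0 \<le> \<bar>of_int k\<bar> * a" "0 \<le> \<bar>of_int k\<bar> * a\<^sup>2" by (simp_all add: a_def)
      then show ?thesis by (simp add: power2_eq_square algebra_simps)
    qed
    finally show "\<bar>real_of_int (e j)\<bar> \<le> (1 + \<bar>of_int k\<bar>) * (1 + \<bar>of_int j\<bar>) ^ 2"
      using e_nonneg[of j] by (simp add: a_def)
  qed
  define r where "r = (q + 1) / 2"
  \<comment> \<open>The left end keeps away from 0, where the exponent \<open>e j - 1\<close> would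
    be negative if \<open>e j = 0\<close>; the right end \<open>r\<close> is below 1, so the series
    at \<open>r\<close> serves as majorant.\<close>
  define S where "S = {q / 2..r}"
  have r: "0 < r" "r < 1" "q < r" using q by (auto simp: r_def)
  have S: "q \<in> S" "q \<in> interior S" using q r by (auto simp: S_def)
  let ?f' = "\<lambda>n x. of_int (e (int_decode n)) * x powi (e (int_decode n) - 1)"
  have bound: "\<bar>?f' n x\<bar> \<le> of_int (e (int_decode n)) * r powi e (int_decode n) / r" if "x \<in> S" for n x
  proof (cases "e (int_decode n) = 0")
    case False
    then have "e (int_decode n) - 1 \<ge> 0" using e_nonneg[of "int_decode n"] by linarith
    moreover have "0 \<le> x" "x \<le> r" using that q by (auto simp: S_def)
    ultimately have "x powi (e (int_decode n) - 1) \<le> r powi (e (int_decode n) - 1)" "0 \<le> x powi (e (int_decode n) - 1)"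
      by (auto intro: power_int_mono)
    moreover have "r powi (e (int_decode n) - 1) = r powi e (int_decode n) / r"
      using r by (simp add: power_int_diff)
    ultimately show ?thesis
      using e_nonneg[of "int_decode n"]
      by (auto simp: abs_mult simp flip: times_divide_eq_right intro: mult_left_mono)
  qed simp
  have "((\<lambda>x. \<Sum>n. x powi e (int_decode n)) has_field_derivative (\<Sum>n. ?f' n q)) (at q)"
  proof (rule has_field_derivative_series'(2)[of S _ _ q])
    show "convex S" by (simp add: S_def)
    show "((\<lambda>x. x powi e (int_decode n)) has_field_derivative ?f' n x) (at x within S)" if "x \<in> S" for n x
      using that q by (auto simp: S_def intro!: derivative_eq_intros)
    show "uniformly_convergent_on S (\<lambda>n x. \<Sum>i<n. ?f' i x)"
    proof (rule Weierstrass_m_test')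
      show "norm (?f' n x) \<le> of_int (e (int_decode n)) * r powi e (int_decode n) / r" if "x \<in> S" for n x
        using bound[OF that] by simp
      show "summable (\<lambda>n. of_int (e (int_decode n)) * r powi e (int_decode n) / r)"
        by (intro summable_divide summable_norm_cancel[OF infsum_int_eq_suminf(2)[OF sum_e[OF r(1,2)]]])
    qed
    show "summable (\<lambda>n. q powi e (int_decode n))"
      by (rule summable_norm_cancel[OF infsum_int_eq_suminf(2)[OF sum_1[OF q]]])
  qed (use S in auto)
  then have "((\<lambda>x. \<Sum>\<^sub>\<infinity>j. x powi e j) has_field_derivative (\<Sum>n. ?f' n q)) (at q)"
    by (rule has_field_derivative_transform_within_open[of _ _ _ "{0<..<1}"])
       (use q in \<open>auto simp: infsum_int_eq_suminf(1)[OF sum_1]\<close>)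
  moreover have "((\<lambda>j. of_int (e j) * q powi e j) has_sum q * (\<Sum>n. ?f' n q)) UNIV"
  proof -
    have sf: "summable (\<lambda>n. ?f' n q)"
    proof (rule summable_comparison_test')
      show "summable (\<lambda>n. of_int (e (int_decode n)) * r powi e (int_decode n) / r)"
        by (intro summable_divide summable_norm_cancel[OF infsum_int_eq_suminf(2)[OF sum_e[OF r(1,2)]]])
      show "norm (?f' n q) \<le> of_int (e (int_decode n)) * r powi e (int_decode n) / r" for n
        using bound[OF S(1)] by simp
    qed
    have "q * (\<Sum>n. ?f' n q) = (\<Sum>n. q * ?f' n q)" by (rule suminf_mult[OF sf, symmetric])
    also have "\<dots> = (\<Sum>n. of_int (e (int_decode n)) * q powi e (int_decode n))"
      using q by (simp add: power_int_diff)
    also have "\<dots> = (\<Sum>\<^sub>\<infinity>j. of_int (e j) * q powi e j)"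
      by (rule infsum_int_eq_suminf(1)[OF sum_e[OF q], symmetric])
    finally show ?thesis using has_sum_infsum[OF sum_e[OF q]] by simp
  qed
  ultimately show ?thesis by (rule that)
qed

text \<open>In Jacobi's series the terms j = 2 i and j = -1 - 2 i have the same exponent, and with
  the signs their weights add up to 2 i + (1 + 2 i). This leaves a quadratic exponent that can be
  rotated.\<close>

lemma euler_fun_cube_has_sum:
  fixes q :: real
  assumes "0 < q" "q < 1"
  shows "((\<lambda>i. of_int (4 * i + 1) * q powi (2 * i\<^sup>2 + i)) has_sum euler_fun q ^ 3) UNIV"
proof -
  define f where "f j = of_int j * ((-1) powi j * q powi tri j)" for j
  have f: "(f has_sum euler_fun q ^ 3) UNIV"
    using jacobi_cube[OF assms] unfolding f_def .
  have t: "tri (2 * i) = 2 * i\<^sup>2 + i" "tri (-1 - 2 * i) = 2 * i\<^sup>2 + i" for i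
    using two_tri[of "2 * i"] tri_reflect[of "2 * i"] by (simp_all add: power2_eq_square algebra_simps)
  let ?A = "range (\<lambda>i::int. 2 * i)" and ?B = "range (\<lambda>i::int. -1 - 2 * i)"
  have U: "?A \<union> ?B = UNIV"
  proof (intro equalityI subsetI UnCI)
    fix j :: int assume "j \<notin> ?B"
    moreover have "j = -1 - 2 * ((-1 - j) div 2)" if "odd j" using that by presburger
    ultimately have "even j" by blast
    then show "j \<in> ?A" by auto
  qed auto
  have D: "?A \<inter> ?B = {}" by (auto; presburger)
  have s: "f summable_on X" for X
    using summable_on_subset[of f UNIV X] has_sum_imp_summable[OF f] by auto
  have A: "((\<lambda>i. f (2 * i)) has_sum infsum f ?A) UNIV"
    using has_sum_infsum[OF s, of ?A] by (subst (asm) has_sum_reindex) (auto simp: inj_on_def o_def)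
  have B: "((\<lambda>i. f (-1 - 2 * i)) has_sum infsum f ?B) UNIV"
    using has_sum_infsum[OF s, of ?B] by (subst (asm) has_sum_reindex) (auto simp: inj_on_def o_def)
  have "(f has_sum (infsum f ?A + infsum f ?B)) UNIV"
    using has_sum_Un_disjoint[OF has_sum_infsum[OF s, of ?A] has_sum_infsum[OF s, of ?B] D] unfolding U .
  then have "infsum f ?A + infsum f ?B = euler_fun q ^ 3"
    using f by (rule has_sum_unique)
  moreover have "f (2 * i) + f (-1 - 2 * i) = of_int (4 * i + 1) * q powi (2 * i\<^sup>2 + i)" for i
    unfolding f_def t by (simp add: algebra_simps)
  ultimately show ?thesis using has_sum_add[OF A B] by simp
qed

theorem theta_wronskian:
  fixes q :: real
  assumes q: "0 < q" "q < 1"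
  obtains P' F' where "((\<lambda>x. theta_psi (x\<^sup>2)) has_real_derivative P') (at q)"
    "(theta_phi has_real_derivative F') (at q)"
    "euler_fun q ^ 6 = (theta_psi (q\<^sup>2) + 4 * q * P') * theta_phi q - 4 * theta_psi (q\<^sup>2) * (q * F')"
proof -
  define P where "P x = (\<Sum>\<^sub>\<infinity>j. x powi (j\<^sup>2 + j))" for x :: real
  define F where "F x = (\<Sum>\<^sub>\<infinity>j. x powi (j\<^sup>2))" for x :: real
  have ax: "x \<noteq> 0 \<and> \<bar>x\<bar> < 1" if "x \<in> {0<..<1}" for x :: real using that by auto
  have P: "P x = 2 * theta_psi (x\<^sup>2)" and F: "F x = theta_phi x" if "x \<in> {0<..<1}" for x
    unfolding P_def F_def using infsumI theta_psi_sq_has_sum theta_phi_has_sum ax[OF that] by blast+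
  have t0: "2 * tri j - 0 * j = j\<^sup>2 + j" "2 * tri j - 1 * j = j\<^sup>2" for j
    using two_tri[of j] by (simp_all add: power2_eq_square algebra_simps)
  have nn: "j\<^sup>2 + j \<ge> 0" for j :: int using tri_nonneg[of j] t0(1)[of j] by simp
  obtain Pd where Pd: "(P has_real_derivative Pd) (at q)"
    "((\<lambda>j. of_int (j\<^sup>2 + j) * q powi (j\<^sup>2 + j)) has_sum q * Pd) UNIV"
    using theta_series_deriv[OF q, of 0, unfolded t0, OF nn] unfolding P_def[abs_def] by blast
  obtain Fd where Fd: "(F has_real_derivative Fd) (at q)"
    "((\<lambda>j. of_int (j\<^sup>2) * q powi (j\<^sup>2)) has_sum q * Fd) UNIV"
    using theta_series_deriv[OF q, of 1, unfolded t0] unfolding F_def[abs_def] by auto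
  have q01: "q \<in> {0<..<1}" using q by simp
  note ps = theta_psi_sq_has_sum[OF ax[OF q01, THEN conjunct1] ax[OF q01, THEN conjunct2]]
   and ph = theta_phi_has_sum[OF ax[OF q01, THEN conjunct1] ax[OF q01, THEN conjunct2]]
  \<comment> \<open>With s = i + k and d = i - k, (4i + 1)(4k + 1) = (2s + 1)^2 - (2d)^2. Each
    square depends on one variable only, so the sum over the full lattice splits into products of a
    theta series with a differentiated one.\<close>
  define g :: "int \<times> int \<Rightarrow> real" where
    "g = (\<lambda>(s, d). ((of_int (2 * s + 1))\<^sup>2 - 4 * (of_int d)\<^sup>2) * q powi (s\<^sup>2 + s + d\<^sup>2))"
  have g_all: "(g has_sum (4 * (q * Pd) + 2 * theta_psi (q\<^sup>2)) * theta_phi q - 4 * (2 * theta_psi (q\<^sup>2)) * (q * Fd)) UNIV"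
  proof -
    have 1: "((\<lambda>s. of_int (4 * (s\<^sup>2 + s) + 1) * q powi (s\<^sup>2 + s)) has_sum 4 * (q * Pd) + 2 * theta_psi (q\<^sup>2)) UNIV"
      using has_sum_add[OF has_sum_cmult_right[OF Pd(2), of 4] ps] by (simp add: algebra_simps)
    have "g = (\<lambda>p. (case p of (s, d) \<Rightarrow> (of_int (4 * (s\<^sup>2 + s) + 1) * q powi (s\<^sup>2 + s)) * q powi (d\<^sup>2))
        + - (case p of (s, d) \<Rightarrow> (4 * q powi (s\<^sup>2 + s)) * (of_int (d\<^sup>2) * q powi (d\<^sup>2))))"
      using q by (auto simp: g_def power_int_add power2_eq_square algebra_simps)
    then show ?thesis
      using has_sum_add[OF has_sum_product_real[OF 1 ph]
          has_sum_uminusI[OF has_sum_product_real[OF has_sum_cmult_right[OF ps, of 4] Fd(2)]]]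
      by simp
  qed
  have g_even: "(g has_sum euler_fun q ^ 6) {(s, d). even (s + d)}"
  proof -
    note cube = euler_fun_cube_has_sum[OF q]
    have e: "(\<lambda>(i, k). (of_int (4 * i + 1) * q powi (2 * i\<^sup>2 + i)) * (of_int (4 * k + 1) * q powi (2 * k\<^sup>2 + k)))
       = (\<lambda>(i, k). g (i + k, i - k))"
    proof (intro ext, clarify)
      fix i k :: int
      have X: "(i + k)\<^sup>2 + (i + k) + (i - k)\<^sup>2 = (2 * i\<^sup>2 + i) + (2 * k\<^sup>2 + k)"
        by (simp add: power2_eq_square algebra_simps)
      have Y: "(real_of_int (2 * (i + k) + 1))\<^sup>2 - 4 * (real_of_int (i - k))\<^sup>2 = of_int (4 * i + 1) * of_int (4 * k + 1)"
        by (simp add: power2_eq_square algebra_simps)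
      have "g (i + k, i - k) = (of_int (4 * i + 1) * of_int (4 * k + 1)) * q powi ((2 * i\<^sup>2 + i) + (2 * k\<^sup>2 + k))"
        unfolding g_def prod.case X Y ..
      also have "\<dots> = (of_int (4 * i + 1) * q powi (2 * i\<^sup>2 + i)) * (of_int (4 * k + 1) * q powi (2 * k\<^sup>2 + k))"
        using q by (subst power_int_add) auto
      finally show "(of_int (4 * i + 1) * q powi (2 * i\<^sup>2 + i)) * (of_int (4 * k + 1) * q powi (2 * k\<^sup>2 + k)) = g (i + k, i - k)" ..
    qed
    have "euler_fun q ^ 6 = euler_fun q ^ 3 * euler_fun q ^ 3" by (simp add: power_add[symmetric])
    then show ?thesis
      using has_sum_product_real[OF cube cube] unfolding e has_sum_even_iff by simp
  qed
  have g_odd: "(g has_sum euler_fun q ^ 6) {(s, d). odd (s + d)}"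
  proof -
    \<comment> \<open>The reflection s -> -1 - s preserves \<open>g\<close> and exchanges the
      cosets, so the full sum is twice the sixth power.\<close>
    have "(g has_sum euler_fun q ^ 6) {(s, d). even (s + d)} \<longleftrightarrow> (g has_sum euler_fun q ^ 6) {(s, d). odd (s + d)}"
    proof (rule has_sum_reindex_bij_witness[where i = "\<lambda>(s, d). (-1 - s, d)" and j = "\<lambda>(s, d). (-1 - s, d)"])
      fix p :: "int \<times> int"
      obtain s d where p: "p = (s, d)" by (cases p)
      have "(-1 - s)\<^sup>2 + (-1 - s) = s\<^sup>2 + s" "(real_of_int (2 * (-1 - s) + 1))\<^sup>2 = (of_int (2 * s + 1))\<^sup>2"
        by (simp_all add: power2_eq_square algebra_simps)
      then show "g (case p of (s, d) \<Rightarrow> (-1 - s, d)) = g p"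
        unfolding p g_def by (simp only: prod.case)
    qed auto
    with g_even show ?thesis by simp
  qed
  have main: "2 * euler_fun q ^ 6 = (4 * (q * Pd) + 2 * theta_psi (q\<^sup>2)) * theta_phi q - 4 * (2 * theta_psi (q\<^sup>2)) * (q * Fd)"
    using has_sum_unique[OF has_sum_int2_parity[OF g_even g_odd] g_all] by simp
  have "((\<lambda>x. theta_psi (x\<^sup>2)) has_real_derivative Pd / 2) (at q)"
  proof (rule has_field_derivative_transform_within_open[of "\<lambda>x. P x / 2" _ _ "{0<..<1}"])
    show "((\<lambda>x. P x / 2) has_real_derivative Pd / 2) (at q)" by (intro DERIV_cdivide Pd)
  qed (use q P in auto)
  moreover have "(theta_phi has_real_derivative Fd) (at q)"
    by (rule has_field_derivative_transform_within_open[of F _ _ "{0<..<1}"]) (use Fd q F in auto)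
  ultimately show ?thesis
    by (rule that) (use main in \<open>simp add: algebra_simps\<close>)
qed

section \<open>Relations between values of chi\<close>

text \<open>This is phi(q)^4 - phi(-q)^4 = 16 q psi(q^2)^4 divided by f(q^2)^4. Replacing q by -q in
  \<open>theta_phi_sq\<close> changes the sign of one term, so the difference of the squares is a
  product.\<close>

lemma theta_chi_quartic:
  fixes q :: real
  assumes q: "0 < q" "q < 1"
  shows "theta_chi q ^ 8 - theta_chi (- q) ^ 8 = 16 * q / (theta_chi q * theta_chi (- q)) ^ 8"
proof -
  define X C E2 E4 E8 E16 c2 d2 c4 d4 c8 where
    "X = theta_chi q" and "C = theta_chi (- q)" and
    "E2 = euler_fun (q ^ 2)" and "E4 = euler_fun (q ^ 4)" and
    "E8 = euler_fun (q ^ 8)" and "E16 = euler_fun (q ^ 16)" and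
    "c2 = theta_chi (- (q ^ 2))" and "d2 = theta_chi (q ^ 2)" and
    "c4 = theta_chi (- (q ^ 4))" and "d4 = theta_chi (q ^ 4)" and
    "c8 = theta_chi (- (q ^ 8))"
  have lt: "\<bar>q ^ n\<bar> < 1" if "n > 0" for n using q that by (simp add: power_abs power_less_one_iff)
  have q': "q \<noteq> 0" "\<bar>q\<bar> < 1" "- q \<noteq> 0" "\<bar>- q\<bar> < 1" using q by auto
  have E: "E2 = c2 * E4" "E4 = c4 * E8" "E8 = c8 * E16"
    using euler_fun_eq_chi[OF lt[of 2]] euler_fun_eq_chi[OF lt[of 4]] euler_fun_eq_chi[OF lt[of 8]]
    by (simp_all add: E2_def E4_def E8_def E16_def c2_def c4_def c8_def power_mult[symmetric])
  have c: "X * C = c2" "d2 * c2 = c4" "d4 * c4 = c8"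
    using theta_chi_mult_minus[OF q'(2)] theta_chi_mult_minus[OF lt[of 2]] theta_chi_mult_minus[OF lt[of 4]]
    by (simp_all add: X_def C_def c2_def c4_def c8_def d2_def d4_def power_mult[symmetric])
  have pos: "c2 > 0" "d2 > 0" "c4 > 0" "d4 > 0" "c8 > 0" "E16 > 0"
    using lt[of 2] lt[of 4] lt[of 8] lt[of 16] by (auto simp: c2_def d2_def c4_def d4_def c8_def E16_def intro!: theta_chi_pos qpoch_pos)
  have phi: "theta_phi q = E2 * X ^ 2" "theta_phi (- q) = E2 * C ^ 2"
    "theta_phi (q\<^sup>2) = E4 * d2 ^ 2" "theta_psi (q ^ 4) = E16 * d4"
    using theta_phi_eq[OF q'(1,2)] theta_phi_eq[OF q'(3,4)] theta_phi_eq[OF _ lt[of 2]] theta_psi_eq[OF _ lt[of 4]] q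
    by (simp_all add: X_def C_def E2_def E4_def E16_def d2_def d4_def power_mult[symmetric])
  have s: "theta_phi q ^ 2 = theta_phi (q\<^sup>2) ^ 2 + 4 * q * theta_psi (q ^ 4) ^ 2"
    "theta_phi (- q) ^ 2 = theta_phi (q\<^sup>2) ^ 2 - 4 * q * theta_psi (q ^ 4) ^ 2"
    using theta_phi_sq[OF q'(1,2)] theta_phi_sq[OF q'(3,4)] by simp_all
  have "theta_phi q ^ 4 - theta_phi (- q) ^ 4 = 16 * q * theta_phi (q\<^sup>2) ^ 2 * theta_psi (q ^ 4) ^ 2"
  proof -
    have "theta_phi q ^ 4 - theta_phi (- q) ^ 4 = (theta_phi q ^ 2) ^ 2 - (theta_phi (- q) ^ 2) ^ 2" by simp
    also have "\<dots> = 16 * q * theta_phi (q\<^sup>2) ^ 2 * theta_psi (q ^ 4) ^ 2"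
      unfolding s by (simp add: power2_eq_square algebra_simps)
    finally show ?thesis .
  qed
  then have "E2 ^ 4 * (X ^ 8 - C ^ 8) = 16 * q * (E4 * d2 ^ 2) ^ 2 * (E16 * d4) ^ 2"
    unfolding phi by (simp add: power_mult_distrib right_diff_distrib flip: power_mult)
  also have "d2 = c4 / c2" using c pos by (simp add: field_simps)
  also have "d4 = c8 / c4" using c pos by (simp add: field_simps)
  also have "16 * q * (E4 * (c4 / c2) ^ 2) ^ 2 * (E16 * (c8 / c4)) ^ 2 = E2 ^ 4 * (16 * q / c2 ^ 8)"
    unfolding E using pos by (simp add: field_simps eval_nat_numeral)
  finally have "E2 ^ 4 * (X ^ 8 - C ^ 8) = E2 ^ 4 * (16 * q / c2 ^ 8)" .
  moreover have "E2 ^ 4 \<noteq> 0" unfolding E using pos by simp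
  ultimately have "X ^ 8 - C ^ 8 = 16 * q / c2 ^ 8" by (metis mult_left_cancel)
  then show ?thesis unfolding X_def[symmetric] C_def[symmetric] c .
qed

lemma theta_psi_square_eq:
  fixes q :: real
  assumes q: "0 < q" "q < 1"
  shows "theta_psi (q\<^sup>2) = euler_fun (q ^ 4) / (theta_chi q * theta_chi (- q))"
proof -
  have lt: "\<bar>q ^ n\<bar> < 1" if "n > 0" for n
    using q that by (simp add: power_abs power_less_one_iff)
  have "theta_psi (q\<^sup>2) = euler_fun (q ^ 8) * theta_chi (q\<^sup>2)"
    using theta_psi_eq[of "q\<^sup>2"] lt[of 2] q by (simp flip: power_mult)
  moreover have "euler_fun (q ^ 4) = theta_chi (- (q ^ 4)) * euler_fun (q ^ 8)"
    using euler_fun_eq_chi[OF lt[of 4]] by (simp flip: power_mult)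
  moreover have "theta_chi (q\<^sup>2) * theta_chi (- (q\<^sup>2)) = theta_chi (- (q ^ 4))"
    using theta_chi_mult_minus[OF lt[of 2]] by (simp flip: power_mult)
  moreover have "theta_chi q * theta_chi (- q) = theta_chi (- (q\<^sup>2))"
    using theta_chi_mult_minus[of q] q by simp
  moreover have "theta_chi (- (q\<^sup>2)) > 0"
    using lt[of 2] by (auto intro!: theta_chi_pos)
  ultimately show ?thesis
    by (simp add: field_simps)
qed

lemma theta_chi_degree7:
  fixes q :: real
  assumes q: "0 < q" "q < 1"
  shows "theta_chi q * theta_chi (q ^ 7) - theta_chi (- q) * theta_chi (- (q ^ 7))
     = 2 * q / (theta_chi q * theta_chi (q ^ 7) * (theta_chi (- q) * theta_chi (- (q ^ 7))))"
proof -
  have lt: "\<bar>x ^ n\<bar> < 1" if "n > 0" "0 < x" "x < 1" for n and x :: real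
    using q that by (simp add: power_abs power_less_one_iff)
  have psi: "theta_psi x = euler_fun (x ^ 4) * theta_chi x \<and> theta_psi (- x) = euler_fun (x ^ 4) * theta_chi (- x)
     \<and> theta_psi (x\<^sup>2) = euler_fun (x ^ 4) / (theta_chi x * theta_chi (- x))
     \<and> euler_fun (x ^ 4) > 0 \<and> theta_chi x > 0 \<and> theta_chi (- x) > 0" if x: "0 < x" "x < 1" for x :: real
    using theta_psi_eq[of x] theta_psi_eq[of "- x"] theta_psi_square_eq[OF x] lt[of 4 x] x
    by (auto intro!: theta_chi_pos qpoch_pos)
  have q7: "0 < q ^ 7" "q ^ 7 < 1" using q by (auto simp: power_less_one_iff)
  define X C X7 C7 D D7 where "X = theta_chi q" and "C = theta_chi (- q)" and "X7 = theta_chi (q ^ 7)"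
    and "C7 = theta_chi (- (q ^ 7))" and "D = euler_fun (q ^ 4)" and "D7 = euler_fun ((q ^ 7) ^ 4)"
  have "D * X * (D7 * X7) - D * C * (D7 * C7) = 2 * q * (D / (X * C)) * (D7 / (X7 * C7))"
    using theta_psi_degree7[OF q] psi[OF q] psi[OF q7]
    unfolding X_def C_def X7_def C7_def D_def D7_def by (simp flip: power_mult)
  moreover have "D > 0" "D7 > 0" "X > 0" "C > 0" "X7 > 0" "C7 > 0"
    using psi[OF q] psi[OF q7] unfolding X_def C_def X7_def C7_def D_def D7_def by blast+
  ultimately have "(D * D7) * (X * X7 - C * C7) = (D * D7) * (2 * q / (X * X7 * (C * C7)))" "D * D7 \<noteq> 0"
    by (simp_all add: algebra_simps)
  then have "X * X7 - C * C7 = 2 * q / (X * X7 * (C * C7))"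
    by (metis mult_left_cancel)
  then show ?thesis unfolding X_def C_def X7_def C7_def .
qed

text \<open>Equal to phi(q)^4 + 16 q psi(q^2)^4, that is, to the weight 2 Eisenstein series 2 P(q^2)
  - P(q) of level 2, with P(q) = 1 - 24 (sum over n >= 1 of n q^n / (1 - q^n)).\<close>

definition chi_weight :: "real \<Rightarrow> real" where
  "chi_weight q = (theta_chi q ^ 8 + 16 * q / (theta_chi q * theta_chi (- q)) ^ 8) * euler_fun (q\<^sup>2) ^ 4"

lemma theta_chi_deriv:
  fixes q :: real
  assumes q: "0 < q" "q < 1"
  shows "((\<lambda>x. ln (theta_chi (- x))) has_real_derivative (1 - chi_weight q) / (24 * q)) (at q)"
proof -
  obtain P' F' where d: "((\<lambda>x. theta_psi (x\<^sup>2)) has_real_derivative P') (at q)"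
    "(theta_phi has_real_derivative F') (at q)"
    and W: "euler_fun q ^ 6 = (theta_psi (q\<^sup>2) + 4 * q * P') * theta_phi q - 4 * theta_psi (q\<^sup>2) * (q * F')"
    using theta_wronskian[OF q] by blast
  have facts: "theta_phi x = E * X ^ 2 \<and> theta_psi (x\<^sup>2) = E / (X * C) ^ 2 \<and> euler_fun x = C * E
      \<and> E > 0 \<and> X > 0 \<and> C > 0 \<and> X ^ 8 - C ^ 8 = 16 * x / (X * C) ^ 8"
    if x: "0 < x" "x < 1" and d: "E = euler_fun (x\<^sup>2)" "X = theta_chi x" "C = theta_chi (- x)" for x E X C
  proof -
    have x2: "\<bar>x\<^sup>2\<bar> < 1" using x by (simp add: abs_square_less_1)
    have pos: "E > 0" "X > 0" "C > 0"
      unfolding d using x x2 by (auto intro!: theta_chi_pos qpoch_pos)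
    have "E = X * C * euler_fun (x ^ 4)"
      using euler_fun_eq_chi[OF x2] theta_chi_mult_minus[of x] x unfolding d by (simp flip: power_mult)
    then have "theta_psi (x\<^sup>2) = E / (X * C) ^ 2"
      using theta_psi_square_eq[OF x] pos unfolding d[symmetric] by (simp add: power2_eq_square)
    then show ?thesis
      using theta_phi_eq[of x] euler_fun_eq_chi[of x] theta_chi_quartic[OF x] x pos unfolding d by simp
  qed
  \<comment> \<open>The square of the elliptic modulus at nome \<open>x\<close>. It satisfies
    chi(-x)^24 = 16 x (1 - \<alpha>)^2 / \<alpha>, so its derivative is all that is needed.\<close>
  define \<alpha> where "\<alpha> x = 16 * x * theta_psi (x\<^sup>2) ^ 4 / theta_phi x ^ 4" for x :: real
  have ln_chi: "ln (theta_chi (- x)) = (ln 16 + ln x + 2 * ln (1 - \<alpha> x) - ln (\<alpha> x)) / 24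
     \<and> 0 < \<alpha> x \<and> \<alpha> x < 1"
    if x: "x \<in> {0<..<1}" for x
  proof -
    define E X C where d: "E = euler_fun (x\<^sup>2)" "X = theta_chi x" "C = theta_chi (- x)"
    have x': "0 < x" "x < 1" using x by auto
    note f = facts[OF x' d]
    then have pos: "E > 0" "X > 0" "C > 0" by blast+
    have a: "\<alpha> x = 16 * x / (X * C) ^ 8 / X ^ 8"
    proof -
      have ps: "theta_psi (x\<^sup>2) = E / (X * C) ^ 2" "theta_phi x = E * X ^ 2" using f by blast+
      show ?thesis unfolding \<alpha>_def ps using pos by (simp add: field_simps eval_nat_numeral)
    qed
    also have "16 * x / (X * C) ^ 8 = X ^ 8 - C ^ 8" using f by simp
    finally have a1: "1 - \<alpha> x = C ^ 8 / X ^ 8" using pos by (simp add: field_simps)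
    have "ln (1 - \<alpha> x) = 8 * ln C - 8 * ln X" unfolding a1 using pos by (simp add: ln_div ln_realpow)
    moreover have "ln (\<alpha> x) = ln 16 + ln x - 16 * ln X - 8 * ln C"
      unfolding a using pos x' by (simp add: ln_div ln_mult ln_realpow)
    moreover have "0 < \<alpha> x" unfolding a using pos x' by simp
    moreover have "0 < 1 - \<alpha> x" unfolding a1 using pos by simp
    ultimately show ?thesis unfolding d(3)[symmetric] by simp
  qed
  define E X C where dd: "E = euler_fun (q\<^sup>2)" "X = theta_chi q" "C = theta_chi (- q)"
  note f = facts[OF q dd]
  then have pos: "E > 0" "X > 0" "C > 0" by blast+
  have q01: "q \<in> {0<..<1}" using q by simp
  note a01 = ln_chi[OF q01, THEN conjunct2]
  define A' where "A' = \<alpha> q * (C ^ 8 * E ^ 4) / q"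
  have ps: "theta_psi (q\<^sup>2) > 0" "theta_phi q > 0" using f by auto
  \<comment> \<open>The derivative is phi(-q)^4 / q: up to the factor 1/q it is the Wronskian over
    psi(q^2) phi(q).\<close>
  have dln: "((\<lambda>x. ln (\<alpha> x)) has_real_derivative (C ^ 8 * E ^ 4) / q) (at q)"
  proof -
    have "((\<lambda>x. ln 16 + ln x + 4 * ln (theta_psi (x\<^sup>2)) - 4 * ln (theta_phi x)) has_real_derivative
        1 / q + 4 * (P' / theta_psi (q\<^sup>2)) - 4 * (F' / theta_phi q)) (at q)"
      using q ps by (auto intro!: derivative_eq_intros d simp: mult.commute)
    also have "1 / q + 4 * (P' / theta_psi (q\<^sup>2)) - 4 * (F' / theta_phi q)
       = euler_fun q ^ 6 / (theta_psi (q\<^sup>2) * theta_phi q) / q"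
      unfolding W using q ps by (simp add: field_simps)
    also have "euler_fun q ^ 6 / (theta_psi (q\<^sup>2) * theta_phi q) = C ^ 8 * E ^ 4"
    proof -
      have ps: "theta_psi (q\<^sup>2) = E / (X * C) ^ 2" "theta_phi q = E * X ^ 2" "euler_fun q = C * E" using f by blast+
      show ?thesis unfolding ps using pos by (simp add: field_simps eval_nat_numeral)
    qed
    finally show ?thesis
    proof (rule has_field_derivative_transform_within_open[of _ _ _ "{0<..<1}"])
      fix x :: real assume "x \<in> {0<..<1}"
      then have x: "0 < x" "x < 1" by auto
      then have "theta_psi (x\<^sup>2) > 0" "theta_phi x > 0" using facts[OF x refl refl refl] by auto
      then show "ln 16 + ln x + 4 * ln (theta_psi (x\<^sup>2)) - 4 * ln (theta_phi x) = ln (\<alpha> x)"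
        using x by (simp add: \<alpha>_def ln_div ln_mult ln_realpow)
    qed (use q in auto)
  qed
  have da: "(\<alpha> has_real_derivative A') (at q)"
  proof -
    have "((\<lambda>x. exp (ln (\<alpha> x))) has_real_derivative exp (ln (\<alpha> q)) * ((C ^ 8 * E ^ 4) / q)) (at q)"
      by (rule DERIV_fun_exp[OF dln])
    also have "exp (ln (\<alpha> q)) * ((C ^ 8 * E ^ 4) / q) = A'" using a01 by (simp add: A'_def)
    finally show ?thesis
      by (rule has_field_derivative_transform_within_open[of _ _ _ "{0<..<1}"]) (use q ln_chi in auto)
  qed
  have "((\<lambda>x. (ln 16 + ln x + 2 * ln (1 - \<alpha> x) - ln (\<alpha> x)) / 24) has_real_derivative
     (1 / q + 2 * (- A' / (1 - \<alpha> q)) - (C ^ 8 * E ^ 4) / q) / 24) (at q)"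
    using q a01 by (auto intro!: derivative_eq_intros da simp: A'_def mult.commute)
  also have "(1 / q + 2 * (- A' / (1 - \<alpha> q)) - (C ^ 8 * E ^ 4) / q) / 24 = (1 - chi_weight q) / (24 * q)"
  proof -
    define Z where "Z = 16 * q / (X * C) ^ 8"
    have Z: "X ^ 8 - C ^ 8 = Z" using f by (simp add: Z_def)
    have a: "\<alpha> q = Z / X ^ 8"
    proof -
      have ps: "theta_psi (q\<^sup>2) = E / (X * C) ^ 2" "theta_phi q = E * X ^ 2" using f by blast+
      show ?thesis unfolding \<alpha>_def Z_def ps using pos by (simp add: field_simps eval_nat_numeral)
    qed
    have a1: "1 - \<alpha> q = C ^ 8 / X ^ 8" unfolding a Z[symmetric] using pos by (simp add: field_simps)
    have "(1 / q + 2 * (- A' / (1 - \<alpha> q)) - (C ^ 8 * E ^ 4) / q) / 24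
      = (1 / q - (2 * (A' / (1 - \<alpha> q)) + (C ^ 8 * E ^ 4) / q)) / 24" by simp
    also have "2 * (A' / (1 - \<alpha> q)) + (C ^ 8 * E ^ 4) / q = (2 * Z + C ^ 8) * E ^ 4 / q"
      unfolding A'_def a1 unfolding a using pos q by (simp add: field_simps)
    also have "2 * Z + C ^ 8 = X ^ 8 + Z" using Z by simp
    finally show ?thesis
      unfolding chi_weight_def dd[symmetric] Z_def[symmetric] using q by (simp add: diff_divide_distrib mult.commute)
  qed
  finally show ?thesis
    by (rule has_field_derivative_transform_within_open[of _ _ _ "{0<..<1}"]) (use q ln_chi in auto)
qed

section \<open>Algebra at level 14\<close>

text \<open>Arithmetic modulo y^2 - k y + 1. It reduces an identity of high degree in
  \<open>y\<close> to two coefficient identities in \<open>t\<close> alone.\<close>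

lemma mult_mod_quadratic:
  fixes y k a b a' b' :: real
  assumes "y * y = k * y - 1"
  shows "(a + b * y) * (a' + b' * y) = (a * a' - b * b') + (a * b' + b * a' + b * b' * k) * y"
proof -
  have "(a + b * y) * (a' + b' * y) = a * a' + (a * b' + b * a') * y + b * b' * (y * y)"
    by (simp add: algebra_simps)
  then show ?thesis unfolding assms by (simp add: algebra_simps)
qed

text \<open>
  Here \<open>A\<close> and \<open>B\<close> are read off from \<open>49 / (a b) = A \<Lambda> + B / \<Lambda>\<close> with
  \<open>y = \<Lambda>\<^sup>2\<close>. The first identity is proved by reducing each factor to the form
  \<open>\<alpha> + \<beta> y\<close> with \<open>y\<^sup>2 = k y - 1\<close>.
\<close>

lemma level14_multiplier:
  fixes t y k c d A B :: real
  assumes "t > 0" "y > 0" and k: "k = t + 8 / t + 7" and y: "y + 1 / y = k"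
    and c: "c = 3 / 4 * (t - 8 / t)" and d: "d = y - 1 / y"
    and A: "A = t ^ 4 + 12 * t ^ 3 + 35 * t\<^sup>2 + 2 * t - 1"
    and B: "B = - (t ^ 3) - 5 * t\<^sup>2 + 7 * t - 9 + 8 / t"
  shows "(A * y + B) * (d + c)\<^sup>2 * (t ^ 4 + 64 * y ^ 3) = 49 * y\<^sup>2 * (d - c)\<^sup>2 * (t ^ 4 * y ^ 3 + 64)"
    and "(A * y + B) * (A + B * y) = 2401 * y" and "d\<^sup>2 - c\<^sup>2 > 0"
proof -
  have yy: "y * y = k * y - 1" using y \<open>y > 0\<close> by (auto simp: field_simps)
  have d': "d = (- k) + 2 * y" using y d by simp
  have d2: "d * d = k\<^sup>2 - 4" unfolding d' mult_mod_quadratic[OF yy] by (simp add: power2_eq_square)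
  note m = mult_mod_quadratic[OF yy]
  have y2: "y\<^sup>2 = (- 1) + k * y" using yy by (simp add: power2_eq_square)
  have y3: "y ^ 3 = (- k) + (k\<^sup>2 - 1) * y"
  proof -
    have "y ^ 3 = y * (k * y - 1)" unfolding yy[symmetric] by (simp add: power3_eq_cube)
    also have "\<dots> = k * (y * y) - y" by (simp add: algebra_simps)
    finally show ?thesis unfolding yy by (simp add: power2_eq_square algebra_simps)
  qed
  \<comment> \<open>With t w = 8 the coefficients below can be written as polynomials in
    \<open>t\<close> and \<open>w\<close>.\<close>
  define w where "w = 8 / t"
  have kw: "k = t + w + 7" and cw: "4 * c = 3 * (t - w)"
    and Bw: "B = - (t ^ 3) - 5 * t\<^sup>2 + 7 * t - 9 + w"
    using k c B by (simp_all add: w_def)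
  have lin: "a = a' \<Longrightarrow> b = b' \<Longrightarrow> a + b * y = a' + b' * y" for a a' b b' :: real by simp
  \<comment> \<open>The factor 16 clears the denominators that come from c = 3/4 (t - 8/t).\<close>
  have sq: "16 * (d + c)\<^sup>2 = (16 * k\<^sup>2 - 64 + (4 * c)\<^sup>2 - 8 * (4 * c) * k) + (16 * (4 * c)) * y"
    "16 * (d - c)\<^sup>2 = (16 * k\<^sup>2 - 64 + (4 * c)\<^sup>2 + 8 * (4 * c) * k) + (- (16 * (4 * c))) * y"
  proof -
    have "(d + c)\<^sup>2 = d * d + c\<^sup>2 + 2 * c * d" "(d - c)\<^sup>2 = d * d + c\<^sup>2 - 2 * c * d"
      by (simp_all add: power2_eq_square algebra_simps)
    then show "16 * (d + c)\<^sup>2 = (16 * k\<^sup>2 - 64 + (4 * c)\<^sup>2 - 8 * (4 * c) * k) + (16 * (4 * c)) * y"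
      "16 * (d - c)\<^sup>2 = (16 * k\<^sup>2 - 64 + (4 * c)\<^sup>2 + 8 * (4 * c) * k) + (- (16 * (4 * c))) * y"
      unfolding d2 unfolding d' by (simp_all add: algebra_simps power_mult_distrib)
  qed
  have Dp: "16 * (d + c)\<^sup>2 = (t^2  + 56*t  + 832  + 392*w  + 49*w^2)
      + (48*t  - 48*w) * y"
    unfolding sq kw cw
    by (rule lin) (use \<open>t > 0\<close> in \<open>simp_all add: w_def field_simps eval_nat_numeral\<close>)
  have Dm: "16 * (d - c)\<^sup>2 = (49*t^2  + 392*t  + 832  + 56*w  + w^2)
      + (- (48*t)  + 48*w) * y"
    unfolding sq kw cw
    by (rule lin) (use \<open>t > 0\<close> in \<open>simp_all add: w_def field_simps eval_nat_numeral\<close>)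
  have P: "t ^ 4 + 64 * y ^ 3 = (t ^ 4 - 64 * k) + (64 * (k\<^sup>2 - 1)) * y"
    "t ^ 4 * y ^ 3 + 64 = (64 - t ^ 4 * k) + (t ^ 4 * (k\<^sup>2 - 1)) * y"
    unfolding y3 by (simp_all add: algebra_simps)
  have P1: "t ^ 4 + 64 * y ^ 3 = (t^4  - 64*t  - 448  - 64*w)
      + (64*t^2  + 896*t  + 4096  + 896*w  + 64*w^2) * y"
    unfolding P kw
    by (rule lin) (use \<open>t > 0\<close> in \<open>simp_all add: w_def field_simps eval_nat_numeral\<close>)
  have P2: "t ^ 4 * y ^ 3 + 64 = (- (t^5)  - 7*t^4  - 8*t^3  + 64)
      + (t^6  + 14*t^5  + 64*t^4  + 112*t^3  + 64*t^2) * y"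
    unfolding P kw
    by (rule lin) (use \<open>t > 0\<close> in \<open>simp_all add: w_def field_simps eval_nat_numeral\<close>)
  have AB: "A * y + B = B + A * y" "49 * y\<^sup>2 = - 49 + (49 * k) * y" unfolding y2 by simp_all
  have U: "(A * y + B) * (16 * (d + c)\<^sup>2) = (- (49*t^5)  - 637*t^4  - 2401*t^3  - 2401*t^2  - 49*w^2  + 49*w^3)
      + (49*t^6  + 980*t^5  + 7203*t^4  + 24010*t^3  + 36015*t^2  + 19208*t  + 392*w  - 49*w^2) * y"
    unfolding AB Dp m unfolding A Bw kw
    by (rule lin) (use \<open>t > 0\<close> in \<open>simp_all add: w_def field_simps eval_nat_numeral\<close>)
  have V: "49 * y\<^sup>2 * (16 * (d - c)\<^sup>2) = (- (49*t^2)  - 2744*t  - 40768  - 19208*w  - 2401*w^2)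
      + (49*t^3  + 3087*t^2  + 62720*t  + 460992  + 192080*w  + 36015*w^2  + 2401*w^3) * y"
    unfolding AB Dm m unfolding kw
    by (rule lin) (use \<open>t > 0\<close> in \<open>simp_all add: w_def field_simps eval_nat_numeral\<close>)
  have "(A * y + B) * (16 * (d + c)\<^sup>2) * (t ^ 4 + 64 * y ^ 3) = 49 * y\<^sup>2 * (16 * (d - c)\<^sup>2) * (t ^ 4 * y ^ 3 + 64)"
    unfolding U V P1 P2 m unfolding kw
    by (rule lin) (use \<open>t > 0\<close> in \<open>simp_all add: w_def field_simps eval_nat_numeral\<close>)
  then show "(A * y + B) * (d + c)\<^sup>2 * (t ^ 4 + 64 * y ^ 3) = 49 * y\<^sup>2 * (d - c)\<^sup>2 * (t ^ 4 * y ^ 3 + 64)"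
    by simp
  \<comment> \<open>Divided by y, this says that 49 / (a b) and 49 a b have product 2401.\<close>
  have "(B + A * y) * (A + B * y) = 0 + 2401 * y"
    unfolding m
  proof (rule lin, goal_cases)
    case 2
    show ?case unfolding A B c k using \<open>t > 0\<close> by (simp add: field_simps eval_nat_numeral)
  qed simp
  then show "(A * y + B) * (A + B * y) = 2401 * y" by (simp add: add.commute)
  have "d\<^sup>2 - c\<^sup>2 = 7 / 16 * (t + 8 / t)\<^sup>2 + 14 * (t + 8 / t) + 63"
  proof -
    have d2': "d\<^sup>2 = k\<^sup>2 - 4" using d2 by (simp add: power2_eq_square)
    show ?thesis unfolding d2' k c using \<open>t > 0\<close> by (simp add: power2_eq_square field_simps)
  qed
  moreover have "t + 8 / t > 0" using \<open>t > 0\<close> by (simp add: add_pos_pos)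
  ultimately show "d\<^sup>2 - c\<^sup>2 > 0" by (simp add: add_nonneg_pos)
qed

text \<open>\<open>L ^ 2\<close> is invariant under t -> 8/t, and t is a root of x^2 - (L^2 - 5) x +
  8 with conjugate 8/t. Both claims are the quadratic equations of S / L = t and 49 T / L = R,
  multiplied by L^2.\<close>

lemma level14_final:
  fixes t L R T S :: real
  assumes "t > 0" and L: "L\<^sup>2 = t + 8 / t + 5" and S: "S = L * t" and T: "49 * T = L * R"
    and R: "R = t ^ 4 + 13 * t ^ 3 + 40 * t\<^sup>2 - 5 * t + 8 - 8 / t"
  shows "S\<^sup>2 = S * (L ^ 3 - 5 * L) - 8 * L\<^sup>2"
    and "2401 * T\<^sup>2 = 49 * T * (L ^ 9 - 7 * L ^ 7 - 37 * L ^ 5 + 77 * L ^ 3 + 294 * L)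
      + L ^ 12 - 20 * L ^ 10 + 86 * L ^ 8 - 2065 * L ^ 6 - 16317 * L ^ 4 - 22981 * L\<^sup>2"
proof -
  define l where "l = L\<^sup>2"
  have l: "l = t + 8 / t + 5" using L by (simp add: l_def)
  have "S * (L ^ 3 - 5 * L) - 8 * L\<^sup>2 = l * (t * (l - 5) - 8)"
    by (simp add: S l_def power2_eq_square power3_eq_cube algebra_simps)
  also have "t * (l - 5) - 8 = t\<^sup>2" using \<open>t > 0\<close> by (simp add: l power2_eq_square field_simps)
  finally show "S\<^sup>2 = S * (L ^ 3 - 5 * L) - 8 * L\<^sup>2" by (simp add: S l_def power_mult_distrib)
  \<comment> \<open>The quartic in \<open>l\<close> is the trace R(t) + R(8/t), and the quintic is
    -R(t) R(8/t).\<close>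
  have R2: "R\<^sup>2 = R * (l ^ 4 - 7 * l ^ 3 - 37 * l\<^sup>2 + 77 * l + 294)
      + (l ^ 5 - 20 * l ^ 4 + 86 * l ^ 3 - 2065 * l\<^sup>2 - 16317 * l - 22981)"
    unfolding R l using \<open>t > 0\<close> by (simp add: field_simps eval_nat_numeral)
  have "2401 * T\<^sup>2 = (49 * T)\<^sup>2" by (simp add: power2_eq_square)
  also have "\<dots> = l * R\<^sup>2" unfolding T by (simp add: l_def power_mult_distrib)
  also have "\<dots> = (L * R) * (L * (l ^ 4 - 7 * l ^ 3 - 37 * l\<^sup>2 + 77 * l + 294))
      + l * (l ^ 5 - 20 * l ^ 4 + 86 * l ^ 3 - 2065 * l\<^sup>2 - 16317 * l - 22981)"
    unfolding R2 by (simp add: l_def power2_eq_square algebra_simps)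
  also have "L * (l ^ 4 - 7 * l ^ 3 - 37 * l\<^sup>2 + 77 * l + 294)
      = L ^ 9 - 7 * L ^ 7 - 37 * L ^ 5 + 77 * L ^ 3 + 294 * L"
    unfolding l_def by (simp add: eval_nat_numeral algebra_simps)
  also have "l * (l ^ 5 - 20 * l ^ 4 + 86 * l ^ 3 - 2065 * l\<^sup>2 - 16317 * l - 22981)
     = L ^ 12 - 20 * L ^ 10 + 86 * L ^ 8 - 2065 * L ^ 6 - 16317 * L ^ 4 - 22981 * L\<^sup>2"
    unfolding l_def by (simp add: eval_nat_numeral algebra_simps)
  finally show "2401 * T\<^sup>2 = 49 * T * (L ^ 9 - 7 * L ^ 7 - 37 * L ^ 5 + 77 * L ^ 3 + 294 * L)
      + L ^ 12 - 20 * L ^ 10 + 86 * L ^ 8 - 2065 * L ^ 6 - 16317 * L ^ 4 - 22981 * L\<^sup>2"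
    unfolding T by simp
qed

section \<open>Modular relations at level 14\<close>

text \<open>At q = exp(-pi sqrt(m/7)) this is 2^(3/2) (g_{7m} g_{m/7})^3, and
  \<open>septic_y\<close> is (g_{7m} / g_{m/7})^4. The exponents are chosen so that the fractional
  powers of q combine to 1/q.\<close>

definition septic_t :: "real \<Rightarrow> real" where
  "septic_t q = (theta_chi (- q) * theta_chi (- (q ^ 7))) ^ 3 / q"

definition septic_y :: "real \<Rightarrow> real" where
  "septic_y q = theta_chi (- (q ^ 7)) ^ 4 / (q * theta_chi (- q) ^ 4)"

text \<open>X disappears because both the difference of X^8 and 16 q / (X C)^8 and their product
  depend on C and q only.\<close>

lemma theta_chi_square_identity:
  fixes X C q :: real
  assumes "X > 0" "C > 0" and "X ^ 8 - C ^ 8 = 16 * q / (X * C) ^ 8"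
  shows "(X ^ 8 + 16 * q / (X * C) ^ 8)\<^sup>2 = C ^ 16 + 64 * q / C ^ 8"
proof -
  define Z where "Z = 16 * q / (X * C) ^ 8"
  have "(X ^ 8 + Z)\<^sup>2 = (X ^ 8 - Z)\<^sup>2 + 4 * X ^ 8 * Z" by (simp add: power2_eq_square algebra_simps)
  also have "X ^ 8 - Z = C ^ 8" using assms(3) by (simp add: Z_def)
  also have "4 * X ^ 8 * Z = 64 * q / C ^ 8" using assms(1,2) by (simp add: Z_def field_simps)
  finally show ?thesis by (simp add: Z_def)
qed

text \<open>k^3 - 3 k is the tripling map for y + 1/y. It is not injective on all positive reals;
  the bound y + 1/y >= 2 makes the quadratic cofactor positive.\<close>

lemma cubic_cosh_inj:
  fixes k y :: real
  assumes "y > 0" "k > 0" and "y ^ 3 + 1 / y ^ 3 = k ^ 3 - 3 * k"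
  shows "y + 1 / y = k"
proof -
  define K where "K = y + 1 / y"
  have "K \<ge> 2"
  proof -
    have "K - 2 = (y - 1)\<^sup>2 / y" using assms(1) by (simp add: K_def power2_eq_square field_simps)
    then show ?thesis using assms(1) by (metis diff_ge_0_iff_ge divide_nonneg_pos zero_le_power2)
  qed
  have "K ^ 3 - 3 * K = k ^ 3 - 3 * k"
    using assms(1) unfolding assms(3)[symmetric] K_def by (simp add: field_simps eval_nat_numeral)
  then have "(K - k) * (K\<^sup>2 + K * k + k\<^sup>2 - 3) = 0"
    by (simp add: power2_eq_square power3_eq_cube algebra_simps)
  moreover have "K\<^sup>2 \<ge> 4" using power_mono[OF \<open>K \<ge> 2\<close>, of 2] by simp
  then have "K\<^sup>2 + K * k + k\<^sup>2 - 3 > 0"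
    using \<open>K \<ge> 2\<close> \<open>k > 0\<close> by (smt (verit) mult_pos_pos zero_le_power2)
  ultimately show ?thesis by (simp add: K_def)
qed

section \<open>Elimination of X and X7 from the chi identities\<close>

context
  fixes q X C X7 C7 t y :: real
  assumes q: "0 < q" and pos: "X > 0" "C > 0" "X7 > 0" "C7 > 0"
    and quartic: "X ^ 8 - C ^ 8 = 16 * q / (X * C) ^ 8"
    and quartic7: "X7 ^ 8 - C7 ^ 8 = 16 * q ^ 7 / (X7 * C7) ^ 8"
    and septic: "X * X7 - C * C7 = 2 * q / (X * X7 * (C * C7))"
    and t: "t = (C * C7) ^ 3 / q" and y: "y = C7 ^ 4 / (q * C ^ 4)"
begin

lemma ty_pos: "t > 0" "y > 0"
  using q pos by (simp_all add: t y)

lemma ty_powers: "t ^ 4 * y ^ 3 = C7 ^ 24 / q ^ 7" "t ^ 4 / y ^ 3 = C ^ 24 / q"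
  using q pos by (simp_all add: t y field_simps power_mult[symmetric] eval_nat_numeral)

lemma weight_squares:
  "(X ^ 8 + 16 * q / (X * C) ^ 8)\<^sup>2 = q / C ^ 8 * (t ^ 4 / y ^ 3 + 64)"
  "(X7 ^ 8 + 16 * q ^ 7 / (X7 * C7) ^ 8)\<^sup>2 = q ^ 7 / C7 ^ 8 * (t ^ 4 * y ^ 3 + 64)"
  unfolding theta_chi_square_identity[OF pos(1,2) quartic] theta_chi_square_identity[OF pos(3,4) quartic7] ty_powers
  using q pos by (simp_all add: field_simps flip: power_add)

text \<open>The septic identity says that g and n = 2 q / (g h) differ by h. Their product 2 q / h
  also involves h only, so g^4 + n^4 and g^8 + n^8 are expressions in h.\<close>

lemma septic_powers:
  defines "g \<equiv> X * X7" and "h \<equiv> C * C7"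
  shows "g ^ 4 + 16 * q ^ 4 / (g * h) ^ 4 = h ^ 4 + 8 * q * h + 8 * q\<^sup>2 / h\<^sup>2"
    and "g ^ 8 + 256 * q ^ 8 / (g * h) ^ 8 = h ^ 8 + 16 * q * h ^ 5 + 80 * q\<^sup>2 * h\<^sup>2 + 128 * q ^ 3 / h + 32 * q ^ 4 / h ^ 4"
proof -
  define n where "n = 2 * q / (g * h)"
  have gh: "g > 0" "h > 0" using pos by (simp_all add: g_def h_def)
  have 1: "g - n = h" using septic by (simp add: g_def h_def n_def)
  have gn: "g * n = 2 * q / h" using gh by (simp add: n_def)
  have "g\<^sup>2 + n\<^sup>2 = (g - n)\<^sup>2 + 2 * (g * n)" by (simp add: power2_eq_square algebra_simps)
  then have 2: "g\<^sup>2 + n\<^sup>2 = h\<^sup>2 + 4 * q / h" unfolding 1 gn by simp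
  have "g ^ 4 + n ^ 4 = (g\<^sup>2 + n\<^sup>2)\<^sup>2 - 2 * (g * n)\<^sup>2" by (simp add: eval_nat_numeral algebra_simps)
  also have "\<dots> = h ^ 4 + 8 * q * h + 8 * q\<^sup>2 / h\<^sup>2"
    unfolding 2 gn using gh by (simp add: field_simps eval_nat_numeral)
  finally have 4: "g ^ 4 + n ^ 4 = h ^ 4 + 8 * q * h + 8 * q\<^sup>2 / h\<^sup>2" .
  have "g ^ 8 + n ^ 8 = (g ^ 4 + n ^ 4)\<^sup>2 - 2 * (g * n) ^ 4" by (simp add: eval_nat_numeral algebra_simps)
  also have "\<dots> = h ^ 8 + 16 * q * h ^ 5 + 80 * q\<^sup>2 * h\<^sup>2 + 128 * q ^ 3 / h + 32 * q ^ 4 / h ^ 4"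
    unfolding 4 gn using gh by (simp add: field_simps eval_nat_numeral)
  finally have 8: "g ^ 8 + n ^ 8 = h ^ 8 + 16 * q * h ^ 5 + 80 * q\<^sup>2 * h\<^sup>2 + 128 * q ^ 3 / h + 32 * q ^ 4 / h ^ 4" .
  show "g ^ 4 + 16 * q ^ 4 / (g * h) ^ 4 = h ^ 4 + 8 * q * h + 8 * q\<^sup>2 / h\<^sup>2"
    using 4 by (simp add: n_def power_divide power_mult_distrib)
  show "g ^ 8 + 256 * q ^ 8 / (g * h) ^ 8 = h ^ 8 + 16 * q * h ^ 5 + 80 * q\<^sup>2 * h\<^sup>2 + 128 * q ^ 3 / h + 32 * q ^ 4 / h ^ 4"
    using 8 by (simp add: n_def power_divide power_mult_distrib)
qed

lemma level14_relation: "y + 1 / y = t + 8 / t + 7"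
proof (rule cubic_cosh_inj)
  define Z Z7 where "Z = 16 * q / (X * C) ^ 8" and "Z7 = 16 * q ^ 7 / (X7 * C7) ^ 8"
  define h where "h = C * C7"
  have h: "h > 0" using pos by (simp add: h_def)
  have th: "h ^ 3 = t * q" using q by (simp add: t h_def)
  \<comment> \<open>In this form the mixed products cancel: what remains is g^8 + n^8 from
    \<open>septic_powers\<close> and the known differences.\<close>
  have "(X ^ 8 + Z) * (X7 ^ 8 + Z7) = 2 * (X ^ 8 * X7 ^ 8 + Z * Z7) - (X ^ 8 - Z) * (X7 ^ 8 - Z7)"
    by (simp add: algebra_simps)
  also have "X ^ 8 - Z = C ^ 8" using quartic by (simp add: Z_def)
  also have "X7 ^ 8 - Z7 = C7 ^ 8" using quartic7 by (simp add: Z7_def)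
  also have "X ^ 8 * X7 ^ 8 + Z * Z7 = (X * X7) ^ 8 + 256 * q ^ 8 / (X * X7 * (C * C7)) ^ 8"
    using pos by (simp add: Z_def Z7_def power_mult_distrib field_simps flip: power_Suc power_add)
  also have "2 * \<dots> - C ^ 8 * C7 ^ 8 = h ^ 8 + 32 * q * h ^ 5 + 160 * q\<^sup>2 * h\<^sup>2 + 256 * q ^ 3 / h + 64 * q ^ 4 / h ^ 4"
    unfolding septic_powers(2) h_def by (simp add: power_mult_distrib)
  also have "\<dots> = (t ^ 4 + 32 * t ^ 3 + 160 * t\<^sup>2 + 256 * t + 64) * (q ^ 4 / h ^ 4)"
  proof -
    have "h ^ 8 + 32 * q * h ^ 5 + 160 * q\<^sup>2 * h\<^sup>2 + 256 * q ^ 3 / h + 64 * q ^ 4 / h ^ 4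
      = ((h ^ 3) ^ 4 / q ^ 4 + 32 * (h ^ 3) ^ 3 / q ^ 3 + 160 * (h ^ 3) ^ 2 / q ^ 2 + 256 * h ^ 3 / q + 64) * (q ^ 4 / h ^ 4)"
      using q h by (simp add: field_simps eval_nat_numeral)
    then show ?thesis unfolding th using q by (simp add: power_mult_distrib)
  qed
  finally have r: "(X ^ 8 + Z) * (X7 ^ 8 + Z7) = (t ^ 4 + 32 * t ^ 3 + 160 * t\<^sup>2 + 256 * t + 64) * (q ^ 4 / h ^ 4)" .
  have "((X ^ 8 + Z) * (X7 ^ 8 + Z7))\<^sup>2 = (q / C ^ 8 * (t ^ 4 / y ^ 3 + 64)) * (q ^ 7 / C7 ^ 8 * (t ^ 4 * y ^ 3 + 64))"
    using weight_squares power_mult_distrib[of "X ^ 8 + Z" "X7 ^ 8 + Z7" 2] by (simp only: Z_def Z7_def)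
  also have "\<dots> = (t ^ 4 / y ^ 3 + 64) * (t ^ 4 * y ^ 3 + 64) * (q ^ 4 / h ^ 4)\<^sup>2"
    using pos q unfolding h_def by (simp add: field_simps eval_nat_numeral)
  finally have "(t ^ 4 + 32 * t ^ 3 + 160 * t\<^sup>2 + 256 * t + 64)\<^sup>2 * (q ^ 4 / h ^ 4)\<^sup>2
     = (t ^ 4 / y ^ 3 + 64) * (t ^ 4 * y ^ 3 + 64) * (q ^ 4 / h ^ 4)\<^sup>2"
    unfolding r power_mult_distrib .
  moreover have "(q ^ 4 / h ^ 4)\<^sup>2 \<noteq> 0" using q h by simp
  ultimately have "(t ^ 4 + 32 * t ^ 3 + 160 * t\<^sup>2 + 256 * t + 64)\<^sup>2 = (t ^ 4 / y ^ 3 + 64) * (t ^ 4 * y ^ 3 + 64)"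
    by (metis mult_right_cancel)
  also have "\<dots> = t ^ 8 + 64 * t ^ 4 * (y ^ 3 + 1 / y ^ 3) + 4096"
    using ty_pos by (simp add: field_simps flip: power_add)
  finally have "64 * t ^ 4 * (y ^ 3 + 1 / y ^ 3) = (t ^ 4 + 32 * t ^ 3 + 160 * t\<^sup>2 + 256 * t + 64)\<^sup>2 - t ^ 8 - 4096"
    by simp
  \<comment> \<open>The constant 7 can be read from the coefficient of t^6: 32^2 + 2 * 160 = 64 * 3
    * 7.\<close>
  also have "\<dots> = 64 * t ^ 4 * ((t + 8 / t + 7) ^ 3 - 3 * (t + 8 / t + 7))"
    using ty_pos by (simp add: field_simps eval_nat_numeral)
  finally show "y ^ 3 + 1 / y ^ 3 = (t + 8 / t + 7) ^ 3 - 3 * (t + 8 / t + 7)"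
    using ty_pos by simp
qed (use ty_pos in \<open>simp_all add: add_pos_pos\<close>)

text \<open>Used with v = \<Lambda> and r = a / b. The difference r - 1/r is proportional to Y7 -
  q^3 Y, which divides C7^12 - q^3 C^12, a multiple of y^3 - 1; the cofactor \<open>M\<close> is
  known from \<open>septic_powers\<close>.\<close>

lemma level28_relation:
  assumes v: "v > 0" "v\<^sup>2 = y" and a: "r = v * (X7 / X) ^ 4 / q"
  shows "r - 1 / r = (v - 1 / v) * t"
proof -
  define g h where "g = X * X7" and "h = C * C7"
  \<comment> \<open>Multiplied by C^4, the quartic relation involves X only through this monomial:
    C^12 = Y - 16 q / Y.\<close>
  define Y Y7 where "Y = X ^ 8 * C ^ 4" and "Y7 = X7 ^ 8 * C7 ^ 4"
  have gh: "g > 0" "h > 0" using pos by (simp_all add: g_def h_def)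
  have Yp: "Y > 0" "Y7 > 0" using pos by (simp_all add: Y_def Y7_def)
  have "Y - C ^ 12 = (X ^ 8 - C ^ 8) * C ^ 4" by (simp add: Y_def algebra_simps flip: power_add)
  then have Y: "C ^ 12 = Y - 16 * q / Y" 
    unfolding quartic Y_def using pos by (simp add: field_simps eval_nat_numeral)
  have "Y7 - C7 ^ 12 = (X7 ^ 8 - C7 ^ 8) * C7 ^ 4" by (simp add: Y7_def algebra_simps flip: power_add)
  then have Y7: "C7 ^ 12 = Y7 - 16 * q ^ 7 / Y7" 
    unfolding quartic7 Y7_def using pos by (simp add: field_simps eval_nat_numeral)
  define M where "M = 1 + 16 * q ^ 4 / (Y * Y7)"
  have M: "M > 0" using q Yp by (simp add: M_def add_pos_pos)
  have N: "C7 ^ 12 - q ^ 3 * C ^ 12 = (Y7 - q ^ 3 * Y) * M"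
    unfolding Y Y7 M_def using Yp by (simp add: field_simps eval_nat_numeral)
  have gM: "h\<^sup>2 * g ^ 4 * M = q\<^sup>2 * (t\<^sup>2 + 8 * t + 8)"
  proof -
    have "Y * Y7 = g ^ 8 * h ^ 4" by (simp add: Y_def Y7_def g_def h_def power_mult_distrib)
    then have "h\<^sup>2 * g ^ 4 * M = h\<^sup>2 * (g ^ 4 + 16 * q ^ 4 / (g * h) ^ 4)"
      using gh by (simp add: M_def field_simps eval_nat_numeral)
    also have "\<dots> = h\<^sup>2 * (h ^ 4 + 8 * q * h + 8 * q\<^sup>2 / h\<^sup>2)"
      using septic_powers(1) by (simp add: g_def h_def)
    also have "\<dots> = (h ^ 3)\<^sup>2 + 8 * q * h ^ 3 + 8 * q\<^sup>2"
      using gh by (simp add: field_simps eval_nat_numeral)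
    also have "h ^ 3 = q * t" using q by (simp add: t h_def)
    finally show ?thesis by (simp add: power2_eq_square algebra_simps)
  qed
  have yq: "y * (q * C ^ 4) = C7 ^ 4" using q pos by (simp add: y)
  have X7X: "(X7 / X) ^ 4 * (X7 / X) ^ 4 = (X7 / X) ^ 8" by (simp flip: power_add)
  have "v * (r - 1 / r) * (q * (X7 / X) ^ 4) = y * (X7 / X) ^ 8 - q\<^sup>2"
    unfolding a v(2)[symmetric] using v q pos X7X by (simp add: field_simps power2_eq_square)
  also have "\<dots> = (Y7 - q ^ 3 * Y) / (q * C ^ 4 * X ^ 8)"
    using q pos by (simp add: y Y_def Y7_def field_simps eval_nat_numeral)
  finally have S1: "v * (r - 1 / r) * (q * (X7 / X) ^ 4) * (q * C ^ 4 * X ^ 8) * M = C7 ^ 12 - q ^ 3 * C ^ 12"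
    unfolding N using q pos by simp
  have "(C7 ^ 12 - q ^ 3 * C ^ 12) = q ^ 3 * C ^ 12 * (y ^ 3 - 1)"
    using q pos by (simp add: y field_simps eval_nat_numeral)
  moreover have "(q * (X7 / X) ^ 4) * (q * C ^ 4 * X ^ 8) * M = q\<^sup>2 * (C\<^sup>2 / C7\<^sup>2) * (h\<^sup>2 * g ^ 4 * M)"
    using pos by (simp add: g_def h_def field_simps eval_nat_numeral)
  ultimately have "v * (r - 1 / r) * (q\<^sup>2 * (C\<^sup>2 / C7\<^sup>2) * (q\<^sup>2 * (t\<^sup>2 + 8 * t + 8))) = q ^ 3 * C ^ 12 * (y ^ 3 - 1)"
    using S1 unfolding gM by (simp add: mult.assoc)
  moreover define J where "J = q\<^sup>2 * (C\<^sup>2 / C7\<^sup>2) * q\<^sup>2"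
  ultimately have S2: "v * (r - 1 / r) * (J * (t\<^sup>2 + 8 * t + 8)) = q ^ 3 * C ^ 12 * (y ^ 3 - 1)"
    by (simp only: mult.assoc)
  have Jt: "q ^ 3 * C ^ 12 * y = J * t\<^sup>2"
    using q pos unfolding J_def by (simp add: y t field_simps eval_nat_numeral)
  have "J * (y * (v * (r - 1 / r)) * (t\<^sup>2 + 8 * t + 8)) = y * (v * (r - 1 / r) * (J * (t\<^sup>2 + 8 * t + 8)))"
    by (simp only: mult_ac)
  also have "\<dots> = (q ^ 3 * C ^ 12 * y) * (y ^ 3 - 1)" unfolding S2 by (simp only: mult_ac)
  also have "\<dots> = J * (t\<^sup>2 * (y ^ 3 - 1))" unfolding Jt by (simp only: mult_ac)
  finally have "J * (y * (v * (r - 1 / r)) * (t\<^sup>2 + 8 * t + 8)) = J * (t\<^sup>2 * (y ^ 3 - 1))" .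
  moreover have "J \<noteq> 0" using q pos by (simp add: J_def)
  ultimately have S3: "y * (v * (r - 1 / r)) * (t\<^sup>2 + 8 * t + 8) = t\<^sup>2 * (y ^ 3 - 1)"
    by (metis mult_left_cancel)
  have "y ^ 3 - 1 = (y - 1) * y * (y + 1 / y + 1)"
    using ty_pos by (simp add: field_simps eval_nat_numeral)
  \<comment> \<open>The level 14 relation turns this factor of y^3 - 1 into the polynomial t^2 + 8 t
    + 8 already met in \<open>gM\<close>, so it cancels.\<close>
  also have "y + 1 / y + 1 = (t\<^sup>2 + 8 * t + 8) / t"
    using level14_relation ty_pos by (simp add: field_simps power2_eq_square)
  finally have y3: "y ^ 3 - 1 = (y - 1) * y * ((t\<^sup>2 + 8 * t + 8) / t)" .
  have "t\<^sup>2 * ((y - 1) * y * (P / t)) = (y * P) * (t * (y - 1))" for P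
    using ty_pos by (simp add: power2_eq_square field_simps)
  from S3[unfolded y3 this]
  have "(y * (t\<^sup>2 + 8 * t + 8)) * (v * (r - 1 / r)) = (y * (t\<^sup>2 + 8 * t + 8)) * (t * (y - 1))"
    by (simp only: mult_ac)
  moreover have "y * (t\<^sup>2 + 8 * t + 8) \<noteq> 0" using ty_pos by (smt (verit) mult_pos_pos zero_less_power)
  ultimately have "v * (r - 1 / r) = t * (y - 1)" by (metis mult_left_cancel)
  then show ?thesis using v by (simp add: field_simps power2_eq_square)
qed

text \<open>Used with u = 7 W7 / W and H^2 = a b \<Lambda>. \<open>deriv\<close> gives u = (d +
  c)/(d - c), while \<open>weight_squares\<close> makes u^2 / H^2 a function of t and y; equating
  the two determines H^2.\<close>

lemma level14_multiplier_value:
  assumes H: "H > 0"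
    and u: "u = H / q\<^sup>2 * (X7 ^ 8 + 16 * q ^ 7 / (X7 * C7) ^ 8) / (X ^ 8 + 16 * q / (X * C) ^ 8)"
    and deriv: "3 / 4 * (t - 8 / t) * (1 + u) = (y - 1 / y) * (u - 1)"
  defines "A \<equiv> t ^ 4 + 12 * t ^ 3 + 35 * t\<^sup>2 + 2 * t - 1"
    and "B \<equiv> - (t ^ 3) - 5 * t\<^sup>2 + 7 * t - 9 + 8 / t"
  shows "(A * y + B) * H\<^sup>2 = 49 * y" "49 * H\<^sup>2 = A + B * y"
proof -
  define c d where "c = 3 / 4 * (t - 8 / t)" and "d = y - 1 / y"
  note mult = level14_multiplier[OF ty_pos refl level14_relation c_def d_def meta_eq_to_obj_eq[OF A_def] meta_eq_to_obj_eq[OF B_def]]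
  \<comment> \<open>Needed below, where (d - c)^2 is cancelled.\<close>
  have dc: "d - c \<noteq> 0"
  proof
    assume "d - c = 0"
    then have "d\<^sup>2 - c\<^sup>2 = 0" by simp
    with mult(3) show False by simp
  qed
  have u1: "u * (d - c) = d + c"
    using deriv unfolding c_def[symmetric] d_def[symmetric] by (simp add: algebra_simps)
  define p where "p = t ^ 4 * y ^ 3 + 64"
  have p: "p > 0" using ty_pos by (simp add: p_def add_pos_pos)
  have u2: "u\<^sup>2 * (y\<^sup>2 * (t ^ 4 / y ^ 3 + 64)) = H\<^sup>2 * p"
  proof -
    have "t ^ 4 / y ^ 3 + 64 > 0" using ty_pos by (simp add: add_pos_pos)
    then have "u\<^sup>2 = H\<^sup>2 / q ^ 4 * (q ^ 7 / C7 ^ 8 * p) / (q / C ^ 8 * (t ^ 4 / y ^ 3 + 64))"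
    proof -
      define \<rho> \<rho>7 where "\<rho> = X ^ 8 + 16 * q / (X * C) ^ 8" and "\<rho>7 = X7 ^ 8 + 16 * q ^ 7 / (X7 * C7) ^ 8"
      have "u\<^sup>2 = H\<^sup>2 / q ^ 4 * \<rho>7\<^sup>2 / \<rho>\<^sup>2"
        unfolding u \<rho>_def[symmetric] \<rho>7_def[symmetric]
        by (simp add: power_divide power_mult_distrib flip: power_mult)
      then show ?thesis unfolding \<rho>_def \<rho>7_def weight_squares p_def .
    qed
    moreover have "y\<^sup>2 = C7 ^ 8 / (q\<^sup>2 * C ^ 8)" by (simp add: y power_divide power_mult_distrib flip: power_mult)
    moreover have "\<And>x. x > 0 \<Longrightarrow> (H\<^sup>2 / q ^ 4 * (q ^ 7 / C7 ^ 8 * p) / (q / C ^ 8 * x)) * (C7 ^ 8 / (q\<^sup>2 * C ^ 8) * x) = H\<^sup>2 * p"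
      using q pos by (simp add: field_simps eval_nat_numeral)
    ultimately show ?thesis using \<open>t ^ 4 / y ^ 3 + 64 > 0\<close> by simp
  qed
  have "t ^ 4 + 64 * y ^ 3 = y * (y\<^sup>2 * (t ^ 4 / y ^ 3 + 64))"
    using ty_pos by (simp add: field_simps eval_nat_numeral)
  then have "(d + c)\<^sup>2 * (t ^ 4 + 64 * y ^ 3) = (u * (d - c))\<^sup>2 * (y * (y\<^sup>2 * (t ^ 4 / y ^ 3 + 64)))"
    unfolding u1 by simp
  also have "\<dots> = y * (d - c)\<^sup>2 * (u\<^sup>2 * (y\<^sup>2 * (t ^ 4 / y ^ 3 + 64)))"
    by (simp add: power_mult_distrib mult_ac)
  finally have e: "(d + c)\<^sup>2 * (t ^ 4 + 64 * y ^ 3) = y * (d - c)\<^sup>2 * (H\<^sup>2 * p)" unfolding u2 .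
  have "(A * y + B) * ((d + c)\<^sup>2 * (t ^ 4 + 64 * y ^ 3)) = 49 * y\<^sup>2 * (d - c)\<^sup>2 * p"
    using mult(1) by (simp add: p_def mult.assoc)
  then have "(y * (d - c)\<^sup>2 * p) * ((A * y + B) * H\<^sup>2) = (y * (d - c)\<^sup>2 * p) * (49 * y)"
    unfolding e by (simp add: power2_eq_square mult_ac)
  moreover have "y * (d - c)\<^sup>2 * p \<noteq> 0" using dc p ty_pos by simp
  ultimately show 1: "(A * y + B) * H\<^sup>2 = 49 * y" by (metis mult_left_cancel)
  have "2401 * y * H\<^sup>2 = 49 * y * (A + B * y)"
    using mult(2) 1 by (metis mult.assoc mult.commute)
  then show "49 * H\<^sup>2 = A + B * y" using ty_pos by simp
qed

end

section \<open>The level 14 relation for theta values and its derivative\<close>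

lemma septic_hyps:
  fixes q :: real
  assumes q: "0 < q" "q < 1"
  shows "theta_chi q > 0" "theta_chi (- q) > 0" "theta_chi (q ^ 7) > 0" "theta_chi (- (q ^ 7)) > 0"
    "theta_chi q ^ 8 - theta_chi (- q) ^ 8 = 16 * q / (theta_chi q * theta_chi (- q)) ^ 8"
    "theta_chi (q ^ 7) ^ 8 - theta_chi (- (q ^ 7)) ^ 8 = 16 * q ^ 7 / (theta_chi (q ^ 7) * theta_chi (- (q ^ 7))) ^ 8"
    "theta_chi q * theta_chi (q ^ 7) - theta_chi (- q) * theta_chi (- (q ^ 7))
     = 2 * q / (theta_chi q * theta_chi (q ^ 7) * (theta_chi (- q) * theta_chi (- (q ^ 7))))"
proof -
  have q7: "0 < q ^ 7" "q ^ 7 < 1" using q by (auto simp: power_less_one_iff)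
  show "theta_chi q > 0" "theta_chi (- q) > 0" "theta_chi (q ^ 7) > 0" "theta_chi (- (q ^ 7)) > 0"
    using q q7 by (auto intro!: theta_chi_pos)
  show "theta_chi q ^ 8 - theta_chi (- q) ^ 8 = 16 * q / (theta_chi q * theta_chi (- q)) ^ 8"
    by (rule theta_chi_quartic[OF q])
  show "theta_chi (q ^ 7) ^ 8 - theta_chi (- (q ^ 7)) ^ 8 = 16 * q ^ 7 / (theta_chi (q ^ 7) * theta_chi (- (q ^ 7))) ^ 8"
    by (rule theta_chi_quartic[OF q7])
qed (rule theta_chi_degree7[OF q])

lemma septic_relation:
  assumes q: "0 < q" "q < 1"
  shows "septic_y q + 1 / septic_y q = septic_t q + 8 / septic_t q + 7"
  by (rule level14_relation[OF q(1) septic_hyps[OF q] septic_t_def septic_y_def])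

text \<open>The q-logarithmic derivatives of t and y are -(W + 7 W7)/8 and (W - 7 W7)/6. Their
  constant terms vanish thanks to the factor 1/q in both definitions, so the result is homogeneous
  in W and W7.\<close>

lemma septic_deriv:
  fixes q :: real
  assumes q: "0 < q" "q < 1"
  defines "t \<equiv> septic_t q" and "y \<equiv> septic_y q" and "W \<equiv> chi_weight q" and "W7 \<equiv> chi_weight (q ^ 7)"
  shows "3 / 4 * (t - 8 / t) * (W + 7 * W7) = (y - 1 / y) * (7 * W7 - W)"
proof -
  define c where "c x = ln (theta_chi (- x))" for x :: real
  define lt where "lt x = 3 * c x + 3 * c (x ^ 7) - ln x" for x
  define ly where "ly x = 4 * c (x ^ 7) - 4 * c x - ln x" for x
  have e: "exp (lt x) = septic_t x" "exp (ly x) = septic_y x" "septic_t x > 0" "septic_y x > 0"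
    if "x \<in> {0<..<1}" for x
  proof -
    have x: "0 < x" "x < 1" using that by auto
    note pos = septic_hyps(2,4)[OF x]
    have p: "exp (3 * c z) = exp (c z) ^ 3" "exp (4 * c z) = exp (c z) ^ 4" for z
      by (simp_all flip: exp_of_nat_mult)
    show "exp (lt x) = septic_t x" "exp (ly x) = septic_y x" "septic_t x > 0" "septic_y x > 0"
      using pos x unfolding lt_def ly_def septic_t_def septic_y_def exp_diff exp_add p
      by (simp_all add: c_def power_mult_distrib)
  qed
  define F where "F x = exp (lt x) + 8 * exp (- lt x) - exp (ly x) - exp (- ly x)" for x
  have q7: "0 < q ^ 7" "q ^ 7 < 1" using q by (auto simp: power_less_one_iff)
  have d1: "(c has_real_derivative (1 - W) / (24 * q)) (at q)"
    unfolding c_def[abs_def] W_def by (rule theta_chi_deriv[OF q])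
  have d7: "((\<lambda>x. c (x ^ 7)) has_real_derivative 7 * (1 - W7) / (24 * q)) (at q)"
  proof -
    have "(c has_real_derivative (1 - W7) / (24 * q ^ 7)) (at (q ^ 7))"
      unfolding c_def[abs_def] W7_def by (rule theta_chi_deriv[OF q7])
    moreover have "((\<lambda>x. x ^ 7) has_real_derivative 7 * q ^ 6) (at q)"
      by (auto intro!: derivative_eq_intros)
    ultimately have "((\<lambda>x. c (x ^ 7)) has_real_derivative (1 - W7) / (24 * q ^ 7) * (7 * q ^ 6)) (at q)"
      by (rule DERIV_chain2)
    also have "(1 - W7) / (24 * q ^ 7) * (7 * q ^ 6) = 7 * (1 - W7) / (24 * q)"
      using q by (simp add: field_simps eval_nat_numeral)
    finally show ?thesis .
  qed
  have dlt: "(lt has_real_derivative - (W + 7 * W7) / (8 * q)) (at q)"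
  proof -
    have "(lt has_real_derivative 3 * ((1 - W) / (24 * q)) + 3 * (7 * (1 - W7) / (24 * q)) - 1 / q) (at q)"
      unfolding lt_def[abs_def] by (intro DERIV_diff DERIV_add DERIV_cmult d1 d7 DERIV_ln_divide q)
    also have "3 * ((1 - W) / (24 * q)) + 3 * (7 * (1 - W7) / (24 * q)) - 1 / q = - (W + 7 * W7) / (8 * q)"
      using q by (simp add: field_simps)
    finally show ?thesis .
  qed
  have dly: "(ly has_real_derivative (W - 7 * W7) / (6 * q)) (at q)"
  proof -
    have "(ly has_real_derivative 4 * (7 * (1 - W7) / (24 * q)) - 4 * ((1 - W) / (24 * q)) - 1 / q) (at q)"
      unfolding ly_def[abs_def] by (intro DERIV_diff DERIV_cmult d1 d7 DERIV_ln_divide q)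
    also have "4 * (7 * (1 - W7) / (24 * q)) - 4 * ((1 - W) / (24 * q)) - 1 / q = (W - 7 * W7) / (6 * q)"
      using q by (simp add: field_simps)
    finally show ?thesis .
  qed
  define a b where "a = - (W + 7 * W7) / (8 * q)" and "b = (W - 7 * W7) / (6 * q)"
  have "(F has_real_derivative (t - 8 / t) * a - (y - 1 / y) * b) (at q)"
  proof -
    have "(F has_real_derivative exp (lt q) * a + 8 * (exp (- lt q) * (- a)) - exp (ly q) * b - exp (- ly q) * (- b)) (at q)"
      unfolding F_def[abs_def]
      by (intro DERIV_diff DERIV_add DERIV_cmult DERIV_fun_exp DERIV_minus dlt[folded a_def] dly[folded b_def])
    also have "exp (lt q) * a + 8 * (exp (- lt q) * (- a)) - exp (ly q) * b - exp (- ly q) * (- b)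
      = (t - 8 / t) * a - (y - 1 / y) * b"
      using e[of q] q by (simp add: exp_minus t_def y_def field_simps)
    finally show ?thesis .
  qed
  moreover have "(F has_real_derivative 0) (at q)"
  proof (rule has_field_derivative_transform_within_open[of "\<lambda>_. -7" _ _ "{0<..<1}"])
    show "- 7 = F x" if "x \<in> {0<..<1}" for x
      using septic_relation[of x] e[OF that] that by (simp add: F_def exp_minus field_simps)
  qed (use q in auto)
  ultimately have "(t - 8 / t) * a = (y - 1 / y) * b"
    using DERIV_unique by force
  then have "(24 * q / 4) * ((t - 8 / t) * a) = (24 * q / 4) * ((y - 1 / y) * b)" by simp
  moreover have "(24 * q / 4) * (z * a) = - (3 / 4 * z * (W + 7 * W7))" "(24 * q / 4) * (z * b) = z * (W - 7 * W7)" for z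
    using q by (simp_all add: a_def b_def field_simps)
  ultimately show ?thesis by (simp only:) (simp add: algebra_simps)
qed

text \<open>The nomes of g_{7m}, g_{m/7}, a_{m,7} and b_{4m,7} are q^7, q, q and q^2. At the common
  q the quotients a and b contain the same power of E7 / E, so it cancels in a / b; X and X7 cancel
  in a b.\<close>

lemma quotients_eq:
  fixes m :: real
  assumes m: "m > 0"
  defines "q \<equiv> exp (- pi * sqrt (m / 7))"
  defines "X \<equiv> theta_chi q" and "C \<equiv> theta_chi (- q)"
    and "X7 \<equiv> theta_chi (q ^ 7)" and "C7 \<equiv> theta_chi (- (q ^ 7))"
    and "E \<equiv> euler_fun (q\<^sup>2)" and "E7 \<equiv> euler_fun ((q ^ 7)\<^sup>2)"
  shows "class_inv_g (7 * m) / class_inv_g (m / 7) = q powr (- 1 / 4) * (C7 / C)"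
    and "a_quot m 7 = 7 * q powr (3 / 2) * (E7 / E) ^ 4 * (X7 / X)\<^sup>2"
    and "b_quot (4 * m) 7 = 7 * q ^ 3 * (E7 / E) ^ 4 * (X * C / (X7 * C7))\<^sup>2"
    and "0 < q" "q < 1" "E > 0" "E7 > 0"
proof -
  show q: "0 < q" "q < 1" using m by (simp_all add: q_def)
  have q7: "0 < q ^ 7" "q ^ 7 < 1" using q by (auto simp: power_less_one_iff)
  note pos = septic_hyps(1-4)[OF q]
  have lt: "\<bar>x ^ n\<bar> < 1" if "n > 0" "0 < x" "x < 1" for n and x :: real
    using that by (simp add: power_abs power_less_one_iff)
  have facts: "theta_psi x = euler_fun (x\<^sup>2) / theta_chi (- x) \<and>
     theta_psi (x\<^sup>2) = euler_fun (x\<^sup>2) / (theta_chi x * theta_chi (- x))\<^sup>2 \<and>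
     theta_phi (- (x\<^sup>2)) = euler_fun (x\<^sup>2) * (theta_chi x * theta_chi (- x)) \<and> euler_fun (x\<^sup>2) > 0" if x: "0 < x" "x < 1" for x :: real
  proof -
    have p: "theta_chi x > 0" "theta_chi (- x) > 0" using x by (auto intro!: theta_chi_pos)
    have "euler_fun (x\<^sup>2) = theta_chi x * theta_chi (- x) * euler_fun (x ^ 4)"
      using euler_fun_eq_chi[OF lt[of 2 x]] theta_chi_mult_minus[of x] x by (simp flip: power_mult)
    moreover have "theta_psi x = euler_fun (x ^ 4) * theta_chi x" using theta_psi_eq[of x] x by simp
    moreover have "theta_phi (- (x\<^sup>2)) = euler_fun (x ^ 4) * (theta_chi x * theta_chi (- x))\<^sup>2"
      using theta_phi_eq[of "- (x\<^sup>2)"] lt[of 2 x] theta_chi_mult_minus[of x] x by (simp flip: power_mult)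
    moreover have "euler_fun (x\<^sup>2) > 0" using lt[of 2 x] x by (auto intro!: qpoch_pos)
    ultimately show ?thesis
      using theta_psi_square_eq[OF x] p by (simp add: field_simps power2_eq_square)
  qed
  show E: "E > 0" "E7 > 0" using facts[OF q] facts[OF q7] by (simp_all add: E_def E7_def)
  have s7: "exp (- pi * sqrt (7 * m)) = q ^ 7"
  proof -
    have "sqrt (7 * m) = sqrt (49 * (m / 7))" by simp
    also have "\<dots> = sqrt 49 * sqrt (m / 7)" by (rule real_sqrt_mult)
    also have "sqrt 49 = (7::real)" by (rule real_sqrt_unique) auto
    finally show ?thesis by (simp add: q_def flip: exp_of_nat_mult)
  qed
  have s4: "exp (- pi * sqrt (4 * m / 7)) = q\<^sup>2"
  proof -
    have "sqrt (4 * m / 7) = sqrt 4 * sqrt (m / 7)" using real_sqrt_mult[of 4 "m / 7"] by simp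
    then show ?thesis by (simp add: q_def flip: exp_of_nat_mult)
  qed
  have pw: "(q ^ n) powr x = q powr (real n * x)" for n x
    using q by (simp add: powr_powr flip: powr_realpow)
  have "class_inv_g (7 * m) / class_inv_g (m / 7) = (q powr (- 7 / 24) / q powr (- 1 / 24)) * (C7 / C)"
    unfolding class_inv_g_def s7 q_def[symmetric] Let_def pw C7_def C_def by simp
  also have "q powr (- 7 / 24) / q powr (- 1 / 24) = q powr (- 1 / 4)"
    using q by (simp flip: powr_diff)
  finally show "class_inv_g (7 * m) / class_inv_g (m / 7) = q powr (- 1 / 4) * (C7 / C)" .
  note pos' = pos[folded X_def C_def X7_def C7_def]
  have f: "theta_psi q = E / C" "theta_psi (q\<^sup>2) = E / (X * C)\<^sup>2" "theta_phi (- (q\<^sup>2)) = E * (X * C)"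
    using facts[OF q] by (simp_all add: E_def X_def C_def)
  have f7: "theta_psi (q ^ 7) = E7 / C7" "theta_psi ((q ^ 7)\<^sup>2) = E7 / (X7 * C7)\<^sup>2"
    "theta_phi (- ((q ^ 7)\<^sup>2)) = E7 * (X7 * C7)"
    using facts[OF q7] unfolding E7_def X7_def C7_def by blast+
  have p14: "q powr 7 = q ^ 7" "q powr 14 = (q ^ 7)\<^sup>2" "q\<^sup>2 powr 7 = (q ^ 7)\<^sup>2" "q\<^sup>2 powr (3 / 2) = q ^ 3"
    using q powr_realpow[of q 7] powr_realpow[of q 14] powr_realpow[of q 3]
    by (simp_all add: pw flip: power_mult)
  have "a_quot m 7 = 7 * q powr (3 / 2) * (theta_psi (q ^ 7))\<^sup>2 * (theta_phi (- ((q ^ 7)\<^sup>2)))\<^sup>2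
        / ((theta_psi q)\<^sup>2 * (theta_phi (- (q\<^sup>2)))\<^sup>2)"
    unfolding a_quot_def Let_def q_def[symmetric] by (simp add: p14)
  also have "\<dots> = 7 * q powr (3 / 2) * (E7 / E) ^ 4 * (X7 / X)\<^sup>2"
    unfolding f f7 using pos' E by (simp add: field_simps eval_nat_numeral)
  finally show "a_quot m 7 = 7 * q powr (3 / 2) * (E7 / E) ^ 4 * (X7 / X)\<^sup>2" .
  have "b_quot (4 * m) 7 = 7 * q ^ 3 * (theta_psi ((q ^ 7)\<^sup>2))\<^sup>2 * (theta_phi (- ((q ^ 7)\<^sup>2)))\<^sup>2
        / ((theta_psi (q\<^sup>2))\<^sup>2 * (theta_phi (- (q\<^sup>2)))\<^sup>2)"
    unfolding b_quot_def Let_def s4 by (simp add: p14)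
  also have "\<dots> = 7 * q ^ 3 * (E7 / E) ^ 4 * (X * C / (X7 * C7))\<^sup>2"
    unfolding f f7 using pos' E by (simp add: field_simps eval_nat_numeral)
  finally show "b_quot (4 * m) 7 = 7 * q ^ 3 * (E7 / E) ^ 4 * (X * C / (X7 * C7))\<^sup>2" .
qed

theorem theorem4p7:
  fixes m \<Lambda> a b S T L :: real
  assumes "m \<in> \<rat>" and "m > 0"
    and "\<Lambda> = (class_inv_g (7 * m) / class_inv_g (m / 7))\<^sup>2"
    and "a = a_quot m 7"
    and "b = b_quot (4 * m) 7"
    and "S = a / b - b / a"
    and "T = 1 / (a * b) - a * b"
    and "L = \<Lambda> - 1 / \<Lambda>"
  shows "S\<^sup>2 = S * (L ^ 3 - 5 * L) - 8 * L\<^sup>2 \<and>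
    2401 * T\<^sup>2 = 49 * T * (L ^ 9 - 7 * L ^ 7 - 37 * L ^ 5 + 77 * L ^ 3 + 294 * L)
      + L ^ 12 - 20 * L ^ 10 + 86 * L ^ 8 - 2065 * L ^ 6 - 16317 * L ^ 4 - 22981 * L\<^sup>2"
proof -
  define q where "q = exp (- pi * sqrt (m / 7))"
  define X C X7 C7 E E7 where "X = theta_chi q" and "C = theta_chi (- q)"
    and "X7 = theta_chi (q ^ 7)" and "C7 = theta_chi (- (q ^ 7))"
    and "E = euler_fun (q\<^sup>2)" and "E7 = euler_fun ((q ^ 7)\<^sup>2)"
  note quot = quotients_eq[OF \<open>m > 0\<close>, folded q_def, folded X_def C_def X7_def C7_def E_def E7_def]
  have q: "0 < q" "q < 1" and E: "E > 0" "E7 > 0" using quot by blast+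
  note hyps = septic_hyps[OF q, folded X_def C_def X7_def C7_def]
  then have pos: "X > 0" "C > 0" "X7 > 0" "C7 > 0" by blast+
  define t y where "t = septic_t q" and "y = septic_y q"
  have t: "t = (C * C7) ^ 3 / q" and y: "y = C7 ^ 4 / (q * C ^ 4)"
    by (simp_all add: t_def y_def septic_t_def septic_y_def C_def C7_def)
  note ctx = q(1) hyps t y
  have ty: "t > 0" "y > 0" using ty_pos[OF ctx] by blast+
  \<comment> \<open>\<Lambda> and a involve half-integral powers of q; with \<open>s\<close> all
    exponents become natural numbers.\<close>
  define s where "s = q powr (1 / 2)"
  have s: "s > 0" "s * s = q" "q powr (3 / 2) = q * s"
    using q powr_add[of q 1 "1 / 2"] by (simp_all add: s_def flip: powr_add)
  have L: "\<Lambda> = C7\<^sup>2 / (s * C\<^sup>2)"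
  proof -
    have "(q powr (- 1 / 4))\<^sup>2 = q powr (- 1 / 2)"
      using q by (simp add: power2_eq_square flip: powr_add)
    then show ?thesis
      using q pos unfolding assms(3) quot(1)
      by (simp add: s_def power_mult_distrib power_divide powr_minus_divide)
  qed
  have \<Lambda>: "\<Lambda> > 0" "\<Lambda>\<^sup>2 = y"
    using pos s(1) q unfolding L y s(2)[symmetric] by (simp_all add: field_simps eval_nat_numeral)
  \<comment> \<open>Chosen so that H^2 = a b \<Lambda>; moreover H / q^2 is the factor 7 (E7 / E)^4
    in the ratio 7 W7 / W.\<close>
  define H where "H = 7 * q\<^sup>2 * (E7 / E) ^ 4"
  have H: "H > 0" using q E by (simp add: H_def)
  have ab: "a / b = \<Lambda> * (X7 / X) ^ 4 / q" "a * b = H\<^sup>2 / \<Lambda>"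
    using pos s q E unfolding assms(4,5) quot(2,3) L s(3) H_def
    by (simp_all add: s(2)[symmetric] field_simps eval_nat_numeral)
  have S: "S = L * t"
    using level28_relation[OF ctx \<Lambda> ab(1)] unfolding assms(6,8) by simp
  have rel: "y + 1 / y = t + 8 / t + 7" by (rule level14_relation[OF ctx])
  define W W7 where "W = chi_weight q" and "W7 = chi_weight (q ^ 7)"
  have Wp: "W > 0" "W7 > 0"
    using pos q E unfolding W_def W7_def chi_weight_def X_def[symmetric] C_def[symmetric] X7_def[symmetric] C7_def[symmetric]
      E_def[symmetric] E7_def[symmetric] by (auto intro!: mult_pos_pos add_pos_pos)
  define u where "u = 7 * W7 / W"
  have u: "u = H / q\<^sup>2 * (X7 ^ 8 + 16 * q ^ 7 / (X7 * C7) ^ 8) / (X ^ 8 + 16 * q / (X * C) ^ 8)"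
    using q E unfolding u_def W_def W7_def chi_weight_def X_def[symmetric] C_def[symmetric] X7_def[symmetric] C7_def[symmetric]
      E_def[symmetric] E7_def[symmetric] H_def by (simp add: power_divide mult_ac)
  have "3 / 4 * (t - 8 / t) * (W + 7 * W7) = (y - 1 / y) * (7 * W7 - W)"
    using septic_deriv[OF q] unfolding t_def y_def W_def W7_def .
  moreover have "W + 7 * W7 = (1 + u) * W" "7 * W7 - W = (u - 1) * W"
    using Wp by (simp_all add: u_def field_simps)
  ultimately have "3 / 4 * (t - 8 / t) * (1 + u) * W = (y - 1 / y) * (u - 1) * W"
    by (simp only: mult.assoc)
  then have "3 / 4 * (t - 8 / t) * (1 + u) = (y - 1 / y) * (u - 1)"
    using Wp by (metis less_irrefl mult_right_cancel)
  note val = level14_multiplier_value[OF ctx H u this]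
  define A B where "A = t ^ 4 + 12 * t ^ 3 + 35 * t\<^sup>2 + 2 * t - 1"
    and "B = - (t ^ 3) - 5 * t\<^sup>2 + 7 * t - 9 + 8 / t"
  note val = val[folded A_def B_def]
  \<comment> \<open>1/(a b) and a b are A \<Lambda> + B / \<Lambda> and A / \<Lambda> + B \<Lambda>
    over 49, so the difference splits off \<Lambda> - 1/\<Lambda>.\<close>
  have T: "49 * T = L * (A - B)"
  proof -
    have y': "y = \<Lambda>\<^sup>2" using \<Lambda> by simp
    have "49 / (a * b) = 49 * y / H\<^sup>2 / \<Lambda>"
      unfolding ab y' using \<Lambda>(1) by (simp add: power2_eq_square)
    also have "49 * y / H\<^sup>2 = A * y + B" using val(1) H by (simp add: field_simps)
    finally have 1: "49 / (a * b) = (A * y + B) / \<Lambda>" .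
    have 2: "49 * (a * b) = (A + B * y) / \<Lambda>" unfolding ab using val(2) by simp
    have "49 * T = 49 / (a * b) - 49 * (a * b)" by (simp add: assms(7))
    also have "\<dots> = (\<Lambda> - 1 / \<Lambda>) * (A - B)"
      unfolding 1 2 y' using \<Lambda>(1) by (simp add: field_simps power2_eq_square)
    finally show ?thesis by (simp add: assms(8))
  qed
  have L2: "L\<^sup>2 = t + 8 / t + 5"
  proof -
    have "L\<^sup>2 = \<Lambda>\<^sup>2 + 1 / \<Lambda>\<^sup>2 - 2"
      unfolding assms(8) using \<Lambda>(1) by (simp add: field_simps power2_eq_square)
    then show ?thesis using rel unfolding \<Lambda>(2) by simp
  qed
  have R: "A - B = t ^ 4 + 13 * t ^ 3 + 40 * t\<^sup>2 - 5 * t + 8 - 8 / t"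
    by (simp add: A_def B_def)
  show ?thesis
    using level14_final[OF ty(1) L2 S T R] by blast
qed

end
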